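(* The problem \textsc{Boxicity} is fixed-parameter tractable when parameterized by the cluster vertex deletion number of the input graph; that is, there is a computable function $f$ and an algorithm that, given a graph $G$ and an integer $d$, decides whether $\mathrm{box}(G)\le d$ in time $f(k)\cdot n^{O(1)}$, where $n=|V(G)|$ and $k$ is the cluster vertex deletion number of $G$.
   Context: A $d$-box is a Cartesian product of $d$ closed real intervals. A $d$-box representation of a graph $G$ assigns to each vertex $v$ a $d$-box $B_v$ such that distinct vertices $u,v$ are adjacent iff $B_u\cap B_v\neq\emptyset$. The boxicity $\mathrm{box}(G)$ is the least $d$ such that $G$ has a $d$-box representation. \textsc{Boxicity}: given a graph $G$ and an integer $d$, decide whether $\mathrm{box}(G)\le d$. A cluster graph is a disjoint union of complete graphs. The cluster vertex deletion number of $G$ is the minimum number of vertices whose deletion from $G$ yields a cluster graph. *)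

theory Defs
  imports
    Complex_Main
    "HOL-Library.FuncSet"
    "HOL-Library.Disjoint_Sets"
    "Graph_Theory.Digraph_Component"
begin

section \<open>Boxicity\<close>

text \<open>The case \<open>d = 0\<close> is allowed: the only 0-box is the one-point set, so
  complete graphs have boxicity 0.\<close>

definition is_box :: "nat \<Rightarrow> (nat \<Rightarrow> real) set \<Rightarrow> bool" where
  "is_box d B \<longleftrightarrow>
     (\<exists>l u. (\<forall>i<d. l i \<le> u i) \<and> B = (\<Pi>\<^sub>E i\<in>{..<d}. {l i..u i}))"

definition box_representation ::
    "('a, 'b) pre_digraph \<Rightarrow> nat \<Rightarrow> ('a \<Rightarrow> (nat \<Rightarrow> real) set) \<Rightarrow> bool" where
  "box_representation G d B \<longleftrightarrow>
     (\<forall>v\<in>verts G. is_box d (B v)) \<and>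
     (\<forall>u\<in>verts G. \<forall>v\<in>verts G. u \<noteq> v \<longrightarrow> (u \<rightarrow>\<^bsub>G\<^esub> v \<longleftrightarrow> B u \<inter> B v \<noteq> {}))"

definition boxicity :: "('a, 'b) pre_digraph \<Rightarrow> nat" where
  "boxicity G = (LEAST d. \<exists>B. box_representation G d B)"


section \<open>Cluster vertex deletion number\<close>

definition cluster_graph :: "('a, 'b) pre_digraph \<Rightarrow> bool" where
  "cluster_graph G \<longleftrightarrow> graph G \<and>
     (\<exists>P. partition_on (verts G) P \<and>
          arcs_ends G = (\<Union>C\<in>P. {(u, v). u \<in> C \<and> v \<in> C \<and> u \<noteq> v}))"

definition cluster_vertex_deletion_number :: "('a, 'b) pre_digraph \<Rightarrow> nat" where
  "cluster_vertex_deletion_number G =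
     (LEAST k. \<exists>S\<subseteq>verts G. card S = k \<and> cluster_graph (G \<restriction> (verts G - S)))"


section \<open>Random access machines\<close>

text \<open>
  Random access machines with the uniform cost measure. Registers are indexed by, and contain,
  natural numbers; the arithmetic instructions are addition, truncated subtraction and halving.
  There is no multiplication, so numbers grow by at most one bit per step and running times are
  polynomially related to those of Turing machines. All registers are initially 0. The input is a
  list of numbers in a separate read-only memory with random access; a machine halts when the
  program counter leaves the program, and its output is the content of register 0.
\<close>

datatype instr =
    Const nat nat      (* R i := c *)
  | Copy nat nat       (* R i := R j *)
  | Add nat nat nat    (* R i := R j + R k *)
  | Sub nat nat nat    (* R i := R j - R k *)
  | Half nat nat       (* R i := R j div 2 *)
  | Load nat nat       (* R i := R (R j) *)
  | Store nat nat      (* R (R i) := R j *)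
  | Read nat nat       (* R i := input (R j) *)
  | Jump nat
  | Jzero nat nat      (* jump to l if R i = 0 *)

type_synonym config = "nat \<times> (nat \<Rightarrow> nat)"

fun exec :: "nat list \<Rightarrow> instr \<Rightarrow> config \<Rightarrow> config" where
  "exec xs (Const i c) (pc, R) = (Suc pc, R(i := c))"
| "exec xs (Copy i j) (pc, R) = (Suc pc, R(i := R j))"
| "exec xs (Add i j k) (pc, R) = (Suc pc, R(i := R j + R k))"
| "exec xs (Sub i j k) (pc, R) = (Suc pc, R(i := R j - R k))"
| "exec xs (Half i j) (pc, R) = (Suc pc, R(i := R j div 2))"
| "exec xs (Load i j) (pc, R) = (Suc pc, R(i := R (R j)))"
| "exec xs (Store i j) (pc, R) = (Suc pc, R(R i := R j))"
| "exec xs (Read i j) (pc, R) =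
     (Suc pc, R(i := (if R j < length xs then xs ! R j else 0)))"
| "exec xs (Jump l) (pc, R) = (l, R)"
| "exec xs (Jzero i l) (pc, R) = (if R i = 0 then l else Suc pc, R)"

definition halted :: "instr list \<Rightarrow> config \<Rightarrow> bool" where
  "halted P c \<longleftrightarrow> length P \<le> fst c"

definition step :: "instr list \<Rightarrow> nat list \<Rightarrow> config \<Rightarrow> config" where
  "step P xs c = (if halted P c then c else exec xs (P ! fst c) c)"

definition run :: "instr list \<Rightarrow> nat list \<Rightarrow> nat \<Rightarrow> config" where
  "run P xs t = (step P xs ^^ t) (0, \<lambda>_. 0)"

definition outputs_within :: "instr list \<Rightarrow> nat list \<Rightarrow> nat \<Rightarrow> nat \<Rightarrow> bool" where
  "outputs_within P xs T y \<longleftrightarrow> (\<exists>t\<le>T. halted P (run P xs t) \<and> snd (run P xs t) 0 = y)"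

definition computable :: "(nat \<Rightarrow> nat) \<Rightarrow> bool" where
  "computable f \<longleftrightarrow> (\<exists>P. \<forall>k. \<exists>T. outputs_within P [k] T (f k))"


section \<open>Instances\<close>

text \<open>A graph with vertex set \<open>{0..<n}\<close> is given by its number of vertices and its
  adjacency matrix in row-major order; the integer \<open>d\<close> is given by sign and absolute value.\<close>

definition boxicity_instance :: "nat pair_pre_digraph \<Rightarrow> int \<Rightarrow> nat list" where
  "boxicity_instance G d =
     (let n = card (pverts G) in
       [n, of_bool (d < 0), nat \<bar>d\<bar>] @
       concat (map (\<lambda>u. map (\<lambda>v. of_bool ((u, v) \<in> parcs G)) [0..<n]) [0..<n]))"

end

theory Submission
  imports Defs
begin

text \<open>A maximal family of disjoint induced paths on three vertices covers a set \<open>S\<close> of at most \<open>3 k\<close>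
  vertices whose removal leaves a cluster graph. Since \<open>G\<close> has a box representation in
  \<open>|S| + 1\<close> dimensions, only \<open>d \<le> |S| + 1\<close> matters. True twins outside \<open>S\<close> can share a box. Call
  two clusters equivalent if the same subsets of \<open>S\<close> occur as neighbourhoods of their vertices. If a
  cluster has sufficiently many equivalent companions, then two of these lie in the same position
  relative to the boxes of \<open>S\<close>, and a further copy fits in next to one of them; so the cluster may
  be deleted. What remains has size bounded in terms of \<open>k\<close> and is solved by exhaustive search over
  integer endpoints.

  The algorithm is written in a small language of total programs with bounded loops. If all loops of
  a run make at most \<open>W\<close> iterations, the compiled program takes time polynomial in \<open>W\<close>, and here
  \<open>W\<close> can be taken as a function of \<open>k\<close> times \<open>n\<close>. The same language makes this function
  computable.\<close>

section \<open>Total programs for random access machines\<close>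

text \<open>The delicate point in inserting a copy is to separate it from the cluster whose boxes it
  imitates. On an axis that separates a box of \<open>C\<close> from a box of \<open>C'\<close>, no
  endpoint of a box of \<open>S\<close> lies between the two facing sides and their common points,
  because \<open>p\<close> and \<open>p'\<close> are in the same cell. These sides are therefore
  irrelevant to \<open>S\<close> and may be pulled in to the common points, after which an
  arbitrarily small displacement of \<open>p\<close> suffices. This dictates what the pigeonhole
  argument must record: the cell of the common point (two comparisons with each of two endpoints per
  vertex of \<open>S\<close> and axis) and which sides of each box reach an endpoint of
  \<open>S\<close> (two per box and axis). Without twins a cluster has at most
  \<open>2 ^ card S\<close> vertices, whence the exponent
  \<open>(2 * 2 ^ card S + 4 * card S) * d\<close>.

  As the machine model has unit cost, a set of vertices and a whole candidate representation can
  each be a single number. Only the lengths of loops have to be controlled, not the size of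
  numbers.\<close>

text \<open>Variables are numbered from the bottom of the environment. The body of \<open>Loop\<close> sees the counter
  and the accumulator, and the body of \<open>Bind\<close> the bound value, at the end of the environment;
  \<open>Last k\<close> discards all but the last \<open>k\<close> values and \<open>Init\<close> discards the last one.\<close>

datatype expr =
    Num nat
  | Var nat
  | Inp expr
  | Plus expr expr
  | Minus expr expr
  | Hlf expr
  | Cond expr expr expr
  | Bind expr expr
  | Last nat expr
  | Init expr
  | Loop expr expr expr

primrec eval :: "nat list \<Rightarrow> expr \<Rightarrow> nat list \<Rightarrow> nat" where
  "eval xs (Num c) env = c"
| "eval xs (Var i) env = (if i < length env then env ! i else 0)"
| "eval xs (Inp a) env = (let j = eval xs a env in if j < length xs then xs ! j else 0)"
| "eval xs (Plus a b) env = eval xs a env + eval xs b env"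
| "eval xs (Minus a b) env = eval xs a env - eval xs b env"
| "eval xs (Hlf a) env = eval xs a env div 2"
| "eval xs (Cond a b c) env = (if eval xs a env = 0 then eval xs c env else eval xs b env)"
| "eval xs (Bind a b) env = eval xs b (env @ [eval xs a env])"
| "eval xs (Last k a) env = eval xs a (drop (length env - k) env)"
| "eval xs (Init a) env = eval xs a (butlast env)"
| "eval xs (Loop a b c) env =
     rec_nat (eval xs b env) (\<lambda>i r. eval xs c (env @ [i, r])) (eval xs a env)"

text \<open>\<open>bnd W xs e env\<close> says that no loop met during the evaluation runs more than \<open>W\<close> times; the
  number of steps is then at most \<open>tcost W e\<close>, which for fixed \<open>e\<close> is a polynomial in \<open>W\<close>.\<close>

primrec bnd :: "nat \<Rightarrow> nat list \<Rightarrow> expr \<Rightarrow> nat list \<Rightarrow> bool" where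
  "bnd W xs (Num c) env = True"
| "bnd W xs (Var i) env = True"
| "bnd W xs (Inp a) env = bnd W xs a env"
| "bnd W xs (Plus a b) env = (bnd W xs a env \<and> bnd W xs b env)"
| "bnd W xs (Minus a b) env = (bnd W xs a env \<and> bnd W xs b env)"
| "bnd W xs (Hlf a) env = bnd W xs a env"
| "bnd W xs (Cond a b c) env =
     (bnd W xs a env \<and> (if eval xs a env = 0 then bnd W xs c env else bnd W xs b env))"
| "bnd W xs (Bind a b) env = (bnd W xs a env \<and> bnd W xs b (env @ [eval xs a env]))"
| "bnd W xs (Last k a) env = bnd W xs a (drop (length env - k) env)"
| "bnd W xs (Init a) env = bnd W xs a (butlast env)"
| "bnd W xs (Loop a b c) env =
     (bnd W xs a env \<and> bnd W xs b env \<and> eval xs a env \<le> W \<and>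
      (\<forall>i<eval xs a env.
         bnd W xs c (env @ [i, rec_nat (eval xs b env) (\<lambda>i r. eval xs c (env @ [i, r])) i])))"

text \<open>Both branches of \<open>Cond\<close> are charged, so the cost does not depend on the
  environment. Besides its body, a loop pass takes six instructions: test, branch, copy of the
  accumulator, and three to advance the counter and jump back.\<close>

primrec tcost :: "nat \<Rightarrow> expr \<Rightarrow> nat" where
  "tcost W (Num c) = 1"
| "tcost W (Var i) = 1"
| "tcost W (Inp a) = tcost W a + 1"
| "tcost W (Plus a b) = tcost W a + tcost W b + 1"
| "tcost W (Minus a b) = tcost W a + tcost W b + 1"
| "tcost W (Hlf a) = tcost W a + 1"
| "tcost W (Cond a b c) = tcost W a + tcost W b + tcost W c + 2"
| "tcost W (Bind a b) = tcost W a + tcost W b + 1"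
| "tcost W (Last k a) = tcost W a"
| "tcost W (Init a) = tcost W a"
| "tcost W (Loop a b c) = tcost W a + tcost W b + W * (tcost W c + 6) + 4"

text \<open>\<open>comp e q rs t\<close> is code to be placed at address \<open>q\<close>; it finds the environment in the
  registers \<open>rs\<close>, leaves the value in register \<open>t\<close> and only changes registers from \<open>t\<close> on.\<close>

primrec comp :: "expr \<Rightarrow> nat \<Rightarrow> nat list \<Rightarrow> nat \<Rightarrow> instr list" where
  "comp (Num c) q rs t = [Const t c]"
| "comp (Var i) q rs t = [if i < length rs then Copy t (rs ! i) else Const t 0]"
| "comp (Inp a) q rs t = comp a q rs t @ [Read t t]"
| "comp (Plus a b) q rs t =
     (let c1 = comp a q rs t; c2 = comp b (q + length c1) rs (t + 1)
      in c1 @ c2 @ [Add t t (t + 1)])"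
| "comp (Minus a b) q rs t =
     (let c1 = comp a q rs t; c2 = comp b (q + length c1) rs (t + 1)
      in c1 @ c2 @ [Sub t t (t + 1)])"
| "comp (Hlf a) q rs t = comp a q rs t @ [Half t t]"
| "comp (Cond a b c) q rs t =
     (let c1 = comp a q rs t; c2 = comp b (q + length c1 + 1) rs t;
          e = q + length c1 + 1 + length c2 + 1; c3 = comp c e rs t
      in c1 @ [Jzero t e] @ c2 @ [Jump (e + length c3)] @ c3)"
| "comp (Bind a b) q rs t =
     (let c1 = comp a q rs t; c2 = comp b (q + length c1) (rs @ [t]) (t + 1)
      in c1 @ c2 @ [Copy t (t + 1)])"
| "comp (Last k a) q rs t = comp a q (drop (length rs - k) rs) t"
| "comp (Init a) q rs t = comp a q (butlast rs) t"
| "comp (Loop a b c) q rs t =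
     (let c1 = comp a q rs t; c2 = comp b (q + length c1) rs (t + 2);
          h = q + length c1 + length c2 + 1;
          c3 = comp c (h + 2) (rs @ [t + 1, t + 2]) (t + 3)
      in c1 @ c2 @ [Const (t + 1) 0] @
         [Sub (t + 3) t (t + 1), Jzero (t + 3) (h + 2 + length c3 + 4)] @ c3 @
         [Copy (t + 2) (t + 3), Const (t + 3) 1, Add (t + 1) (t + 1) (t + 3), Jump h] @
         [Copy t (t + 2)])"

section \<open>Correctness of the compiled code\<close>

definition code_at :: "instr list \<Rightarrow> nat \<Rightarrow> instr list \<Rightarrow> bool" where
  "code_at P q c \<longleftrightarrow> (\<exists>p r. P = p @ c @ r \<and> length p = q)"

lemma code_at_append:
  "code_at P q (c @ c') \<longleftrightarrow> code_at P q c \<and> code_at P (q + length c) c'"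
proof
  assume "code_at P q (c @ c')"
  then obtain p r where "P = p @ (c @ c') @ r" "length p = q" unfolding code_at_def by blast
  then have "P = p @ c @ (c' @ r)" "P = (p @ c) @ c' @ r" "length (p @ c) = q + length c" by auto
  then show "code_at P q c \<and> code_at P (q + length c) c'"
    unfolding code_at_def using \<open>length p = q\<close> by blast
next
  assume "code_at P q c \<and> code_at P (q + length c) c'"
  then obtain p r p' r' where *: "P = p @ c @ r" "length p = q"
      "P = p' @ c' @ r'" "length p' = q + length c"
    unfolding code_at_def by blast
  then have "(p @ c) @ r = p' @ (c' @ r')" "length (p @ c) = length p'" by auto
  then have "p' = p @ c" "r = c' @ r'" by (metis append_eq_append_conv)+
  with * have "P = p @ (c @ c') @ r'" by auto
  then show "code_at P q (c @ c')" unfolding code_at_def using *(2) by blast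
qed

lemma code_at_Cons:
  "code_at P q (i # c) \<longleftrightarrow> code_at P q [i] \<and> code_at P (Suc q) c"
  using code_at_append[of P q "[i]" c] by simp

definition reach :: "instr list \<Rightarrow> nat list \<Rightarrow> nat \<Rightarrow> config \<Rightarrow> config \<Rightarrow> bool" where
  "reach P xs T c c' \<longleftrightarrow> (\<exists>t\<le>T. (step P xs ^^ t) c = c')"

lemma reach_trans:
  assumes "reach P xs T c c'" "reach P xs T' c' c''" "T + T' \<le> T''"
  shows "reach P xs T'' c c''"
proof -
  obtain t t' where "t \<le> T" "(step P xs ^^ t) c = c'" "t' \<le> T'" "(step P xs ^^ t') c' = c''"
    using assms unfolding reach_def by blast
  then have "(step P xs ^^ (t' + t)) c = c''" "t' + t \<le> T''"
    using assms(3) by (auto simp: funpow_add)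
  then show ?thesis unfolding reach_def by blast
qed

lemma reach_mono: "reach P xs T c c' \<Longrightarrow> T \<le> T' \<Longrightarrow> reach P xs T' c c'"
  unfolding reach_def using le_trans by blast

lemma reach_instr:
  assumes "code_at P q [i]" "exec xs i (q, R) = c"
  shows "reach P xs 1 (q, R) c"
proof -
  have "step P xs (q, R) = c"
    using assms by (auto simp: step_def halted_def code_at_def nth_append)
  then have "(step P xs ^^ 1) (q, R) = c" by simp
  then show ?thesis unfolding reach_def by blast
qed

lemma map_cong_below:
  fixes R R' :: "nat \<Rightarrow> nat"
  assumes "\<forall>r\<in>set rs. r < t" "\<forall>r<t. R' r = R r"
  shows "map R' rs = map R rs"
  using assms by auto

text \<open>Registers below \<open>t\<close> survive every piece of code, so the environment held in
  \<open>rs\<close> is intact for the next subexpression, and a first operand waits in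
  \<open>t\<close> while the second is computed from \<open>t + 1\<close> on. Hence the induction
  generalises over \<open>rs\<close>, \<open>t\<close> and \<open>R\<close>.\<close>

lemma comp_correct:
  assumes "code_at P q (comp e q rs t)" "\<forall>r\<in>set rs. r < t" "bnd W xs e (map R rs)"
  shows "\<exists>R'. reach P xs (tcost W e) (q, R) (q + length (comp e q rs t), R') \<and>
    R' t = eval xs e (map R rs) \<and> (\<forall>r<t. R' r = R r)"
  using assms
proof (induction e arbitrary: q rs t R)
  case (Num c)
  then show ?case
    by (intro exI[of _ "R(t := c)"]) (auto intro!: reach_instr[where i = "Const t c", simplified])
next
  case (Var i)
  show ?case
    by (intro exI[of _ "R(t := (if i < length rs then R (rs ! i) else 0))"] conjI)
      (use Var in \<open>auto intro!: reach_instr[simplified] simp: fun_upd_def\<close>)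
next
  case (Inp a)
  let ?c = "comp a q rs t"
  have ca: "code_at P q ?c" "code_at P (q + length ?c) [Read t t]"
    using Inp.prems(1) by (simp_all add: code_at_append)
  from Inp.IH[OF ca(1) Inp.prems(2)] Inp.prems(3) obtain R1 where
    R1: "reach P xs (tcost W a) (q, R) (q + length ?c, R1)"
      "R1 t = eval xs a (map R rs)" "\<forall>r<t. R1 r = R r" by auto
  have "reach P xs 1 (q + length ?c, R1) (Suc (q + length ?c), R1(t := eval xs (Inp a) (map R rs)))"
    by (rule reach_instr[OF ca(2)]) (simp add: R1 Let_def)
  from reach_trans[OF R1(1) this order.refl] R1 show ?case
    by (intro exI[of _ "R1(t := eval xs (Inp a) (map R rs))"]) (auto simp: fun_upd_def)
next
  case (Plus a b)
  let ?c = "comp a q rs t"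
  let ?d = "comp b (q + length ?c) rs (t + 1)"
  have ca: "code_at P q ?c" "code_at P (q + length ?c) ?d"
      "code_at P (q + length ?c + length ?d) [Add t t (t + 1)]"
    using Plus.prems(1) by (simp_all add: code_at_append Let_def)
  from Plus.IH(1)[OF ca(1) Plus.prems(2)] Plus.prems(3) obtain R1 where
    R1: "reach P xs (tcost W a) (q, R) (q + length ?c, R1)"
      "R1 t = eval xs a (map R rs)" "\<forall>r<t. R1 r = R r" by auto
  have m: "map R1 rs = map R rs" by (rule map_cong_below[OF Plus.prems(2) R1(3)])
  have "\<forall>r\<in>set rs. r < t + 1" using Plus.prems(2) by auto
  from Plus.IH(2)[OF ca(2) this, of R1] Plus.prems(3) m obtain R2 where
    R2: "reach P xs (tcost W b) (q + length ?c, R1) (q + length ?c + length ?d, R2)"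
      "R2 (t + 1) = eval xs b (map R rs)" "\<forall>r<t + 1. R2 r = R1 r" by auto
  have 3: "reach P xs 1 (q + length ?c + length ?d, R2)
      (Suc (q + length ?c + length ?d), R2(t := eval xs (Plus a b) (map R rs)))"
    by (rule reach_instr[OF ca(3)]) (use R1(2) R2(2,3) in simp)
  have "reach P xs (tcost W (Plus a b)) (q, R)
      (Suc (q + length ?c + length ?d), R2(t := eval xs (Plus a b) (map R rs)))"
    by (rule reach_trans[OF R1(1) reach_trans[OF R2(1) 3 order.refl]]) simp
  then show ?case using R1 R2
    by (intro exI[of _ "R2(t := eval xs (Plus a b) (map R rs))"]) (auto simp: Let_def add.assoc fun_upd_def)
next
  case (Minus a b)
  let ?c = "comp a q rs t"
  let ?d = "comp b (q + length ?c) rs (t + 1)"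
  have ca: "code_at P q ?c" "code_at P (q + length ?c) ?d"
      "code_at P (q + length ?c + length ?d) [Sub t t (t + 1)]"
    using Minus.prems(1) by (simp_all add: code_at_append Let_def)
  from Minus.IH(1)[OF ca(1) Minus.prems(2)] Minus.prems(3) obtain R1 where
    R1: "reach P xs (tcost W a) (q, R) (q + length ?c, R1)"
      "R1 t = eval xs a (map R rs)" "\<forall>r<t. R1 r = R r" by auto
  have m: "map R1 rs = map R rs" by (rule map_cong_below[OF Minus.prems(2) R1(3)])
  have "\<forall>r\<in>set rs. r < t + 1" using Minus.prems(2) by auto
  from Minus.IH(2)[OF ca(2) this, of R1] Minus.prems(3) m obtain R2 where
    R2: "reach P xs (tcost W b) (q + length ?c, R1) (q + length ?c + length ?d, R2)"
      "R2 (t + 1) = eval xs b (map R rs)" "\<forall>r<t + 1. R2 r = R1 r" by auto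
  have 3: "reach P xs 1 (q + length ?c + length ?d, R2)
      (Suc (q + length ?c + length ?d), R2(t := eval xs (Minus a b) (map R rs)))"
    by (rule reach_instr[OF ca(3)]) (use R1(2) R2(2,3) in simp)
  have "reach P xs (tcost W (Minus a b)) (q, R)
      (Suc (q + length ?c + length ?d), R2(t := eval xs (Minus a b) (map R rs)))"
    by (rule reach_trans[OF R1(1) reach_trans[OF R2(1) 3 order.refl]]) simp
  then show ?case using R1 R2
    by (intro exI[of _ "R2(t := eval xs (Minus a b) (map R rs))"]) (auto simp: Let_def add.assoc fun_upd_def)
next
  case (Hlf a)
  let ?c = "comp a q rs t"
  have ca: "code_at P q ?c" "code_at P (q + length ?c) [Half t t]"
    using Hlf.prems(1) by (simp_all add: code_at_append)
  from Hlf.IH[OF ca(1) Hlf.prems(2)] Hlf.prems(3) obtain R1 where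
    R1: "reach P xs (tcost W a) (q, R) (q + length ?c, R1)"
      "R1 t = eval xs a (map R rs)" "\<forall>r<t. R1 r = R r" by auto
  have "reach P xs 1 (q + length ?c, R1) (Suc (q + length ?c), R1(t := eval xs (Hlf a) (map R rs)))"
    by (rule reach_instr[OF ca(2)]) (use R1 in simp)
  from reach_trans[OF R1(1) this order.refl] R1 show ?case
    by (intro exI[of _ "R1(t := eval xs (Hlf a) (map R rs))"]) (auto simp: fun_upd_def)
next
  case (Cond a b c)
  let ?c = "comp a q rs t"
  let ?d = "comp b (q + length ?c + 1) rs t"
  let ?e = "q + length ?c + 1 + length ?d + 1"
  let ?f = "comp c ?e rs t"
  have ca: "code_at P q ?c" "code_at P (q + length ?c) [Jzero t ?e]"
      "code_at P (q + length ?c + 1) ?d"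
      "code_at P (q + length ?c + 1 + length ?d) [Jump (?e + length ?f)]" "code_at P ?e ?f"
    using Cond.prems(1)
    by (simp_all add: code_at_append Let_def code_at_Cons[of _ _ _ "_ # _"]
        code_at_Cons[of _ _ _ "_ @ _"] code_at_Cons[of _ _ _ "comp _ _ _ _"])
  from Cond.IH(1)[OF ca(1) Cond.prems(2)] Cond.prems(3) obtain R1 where
    R1: "reach P xs (tcost W a) (q, R) (q + length ?c, R1)"
      "R1 t = eval xs a (map R rs)" "\<forall>r<t. R1 r = R r" by auto
  have m: "map R1 rs = map R rs" by (rule map_cong_below[OF Cond.prems(2) R1(3)])
  show ?case
  proof (cases "eval xs a (map R rs) = 0")
    case True
    from Cond.IH(3)[OF ca(5) Cond.prems(2), of R1] Cond.prems(3) m True obtain R2 where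
      R2: "reach P xs (tcost W c) (?e, R1) (?e + length ?f, R2)"
        "R2 t = eval xs c (map R rs)" "\<forall>r<t. R2 r = R1 r" by auto
    have j: "reach P xs 1 (q + length ?c, R1) (?e, R1)"
      by (rule reach_instr[OF ca(2)]) (simp add: R1 True)
    have "reach P xs (tcost W (Cond a b c)) (q, R) (?e + length ?f, R2)"
      by (rule reach_trans[OF R1(1) reach_trans[OF j R2(1) order.refl]]) simp
    then show ?thesis using R1 R2 True
      by (intro exI[of _ R2]) (auto simp: Let_def add.assoc fun_upd_def)
  next
    case False
    from Cond.IH(2)[OF ca(3) Cond.prems(2), of R1] Cond.prems(3) m False obtain R2 where
      R2: "reach P xs (tcost W b) (q + length ?c + 1, R1) (q + length ?c + 1 + length ?d, R2)"
        "R2 t = eval xs b (map R rs)" "\<forall>r<t. R2 r = R1 r" by auto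
    have j: "reach P xs 1 (q + length ?c, R1) (q + length ?c + 1, R1)"
      by (rule reach_instr[OF ca(2)]) (simp add: R1 False)
    have j': "reach P xs 1 (q + length ?c + 1 + length ?d, R2) (?e + length ?f, R2)"
      by (rule reach_instr[OF ca(4)]) simp
    have "reach P xs (tcost W (Cond a b c)) (q, R) (?e + length ?f, R2)"
      by (rule reach_trans[OF R1(1) reach_trans[OF j
              reach_trans[OF R2(1) j' order.refl] order.refl]]) simp
    then show ?thesis using R1 R2 False
      by (intro exI[of _ R2]) (auto simp: Let_def add.assoc fun_upd_def)
  qed
next
  case (Bind a b)
  let ?c = "comp a q rs t"
  let ?d = "comp b (q + length ?c) (rs @ [t]) (t + 1)"
  have ca: "code_at P q ?c" "code_at P (q + length ?c) ?d"
      "code_at P (q + length ?c + length ?d) [Copy t (t + 1)]"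
    using Bind.prems(1) by (simp_all add: code_at_append Let_def)
  from Bind.IH(1)[OF ca(1) Bind.prems(2)] Bind.prems(3) obtain R1 where
    R1: "reach P xs (tcost W a) (q, R) (q + length ?c, R1)"
      "R1 t = eval xs a (map R rs)" "\<forall>r<t. R1 r = R r" by auto
  have m: "map R1 (rs @ [t]) = map R rs @ [eval xs a (map R rs)]"
    using map_cong_below[OF Bind.prems(2) R1(3)] R1(2) by simp
  have "\<forall>r\<in>set (rs @ [t]). r < t + 1" using Bind.prems(2) by auto
  from Bind.IH(2)[OF ca(2) this, of R1] Bind.prems(3) obtain R2 where
    R2: "reach P xs (tcost W b) (q + length ?c, R1) (q + length ?c + length ?d, R2)"
      "R2 (t + 1) = eval xs b (map R rs @ [eval xs a (map R rs)])" "\<forall>r<t + 1. R2 r = R1 r"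
    unfolding m by auto
  have 3: "reach P xs 1 (q + length ?c + length ?d, R2)
      (Suc (q + length ?c + length ?d), R2(t := eval xs (Bind a b) (map R rs)))"
    by (rule reach_instr[OF ca(3)]) (use R2 in simp)
  have "reach P xs (tcost W (Bind a b)) (q, R)
      (Suc (q + length ?c + length ?d), R2(t := eval xs (Bind a b) (map R rs)))"
    by (rule reach_trans[OF R1(1) reach_trans[OF R2(1) 3 order.refl]]) simp
  then show ?case using R1 R2
    by (intro exI[of _ "R2(t := eval xs (Bind a b) (map R rs))"]) (auto simp: Let_def add.assoc fun_upd_def)
next
  case (Last k a)
  \<comment> \<open>Discarding values emits no instruction; only the compile-time list of registers
    gets shorter.\<close>
  have "\<forall>r\<in>set (drop (length rs - k) rs). r < t"
    using Last.prems(2) by (meson in_set_dropD)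
  from Last.IH[OF _ this, of q R] Last.prems show ?case by (auto simp: drop_map)
next
  case (Init a)
  have "\<forall>r\<in>set (butlast rs). r < t"
    using Init.prems(2) by (meson in_set_butlastD)
  from Init.IH[OF _ this, of q R] Init.prems show ?case by (auto simp: map_butlast)
next
  case (Loop a b c)
  let ?c = "comp a q rs t"
  let ?d = "comp b (q + length ?c) rs (t + 2)"
  let ?h = "q + length ?c + length ?d + 1"
  let ?f = "comp c (?h + 2) (rs @ [t + 1, t + 2]) (t + 3)"
  let ?z = "?h + 2 + length ?f"
  define env where "env = map R rs"
  define n where "n = eval xs a env"
  define r where "r i = rec_nat (eval xs b env) (\<lambda>i r. eval xs c (env @ [i, r])) i" for i
  have ca: "code_at P q ?c" "code_at P (q + length ?c) ?d"
      "code_at P (q + length ?c + length ?d) [Const (t + 1) 0]"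
      "code_at P ?h [Sub (t + 3) t (t + 1)]" "code_at P (?h + 1) [Jzero (t + 3) (?z + 4)]"
      "code_at P (?h + 2) ?f" "code_at P ?z [Copy (t + 2) (t + 3)]"
      "code_at P (?z + 1) [Const (t + 3) 1]" "code_at P (?z + 2) [Add (t + 1) (t + 1) (t + 3)]"
      "code_at P (?z + 3) [Jump ?h]" "code_at P (?z + 4) [Copy t (t + 2)]"
    using Loop.prems(1)
    by (simp_all add: code_at_append Let_def code_at_Cons[of _ _ _ "_ # _"]
        code_at_Cons[of _ _ _ "_ @ _"] add.assoc eval_nat_numeral)
  have b: "bnd W xs a env" "bnd W xs b env" "n \<le> W" "\<And>i. i < n \<Longrightarrow> bnd W xs c (env @ [i, r i])"
    using Loop.prems(3) by (simp_all add: env_def n_def r_def)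
  from Loop.IH(1)[OF ca(1) Loop.prems(2)] b(1) obtain R1 where
    R1: "reach P xs (tcost W a) (q, R) (q + length ?c, R1)"
      "R1 t = n" "\<forall>r<t. R1 r = R r" by (auto simp: env_def n_def)
  have m: "map R1 rs = env" unfolding env_def by (rule map_cong_below[OF Loop.prems(2) R1(3)])
  have "\<forall>r\<in>set rs. r < t + 2" using Loop.prems(2) by auto
  from Loop.IH(2)[OF ca(2) this, of R1] b(2) obtain R2 where
    R2: "reach P xs (tcost W b) (q + length ?c, R1) (q + length ?c + length ?d, R2)"
      "R2 (t + 2) = r 0" "\<forall>r<t + 2. R2 r = R1 r"
    unfolding m r_def by auto
  have 3: "reach P xs 1 (q + length ?c + length ?d, R2) (?h, R2(t + 1 := 0))"
    by (rule reach_instr[OF ca(3)]) simp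
  \<comment> \<open>State at the loop head after \<open>i\<close> passes: \<open>t\<close> holds the
    number of passes to make, \<open>t + 1\<close> the counter, \<open>t + 2\<close> the
    accumulator. The test and the body work from \<open>t + 3\<close> on.\<close>
  have lp: "\<exists>R'. reach P xs (tcost W a + tcost W b + 1 + i * (tcost W c + 6)) (q, R) (?h, R') \<and>
      R' t = n \<and> R' (t + 1) = i \<and> R' (t + 2) = r i \<and> (\<forall>r<t. R' r = R r)" if "i \<le> n" for i
    using that
  proof (induction i)
    case 0
    have "reach P xs (tcost W a + tcost W b + 1) (q, R) (?h, R2(t + 1 := 0))"
      by (rule reach_trans[OF R1(1) reach_trans[OF R2(1) 3 order.refl]]) simp
    then show ?case using R1 R2 by (intro exI[of _ "R2(t + 1 := 0)"]) (auto simp: fun_upd_def)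
  next
    case (Suc i)
    then obtain R3 where R3: "reach P xs (tcost W a + tcost W b + 1 + i * (tcost W c + 6)) (q, R) (?h, R3)"
       "R3 t = n" "R3 (t + 1) = i" "R3 (t + 2) = r i" "\<forall>r<t. R3 r = R r" by auto
    define R4 where "R4 = R3(t + 3 := n - i)"
    have s1: "reach P xs 1 (?h, R3) (?h + 1, R4)"
      by (rule reach_instr[OF ca(4)]) (use R3 in \<open>simp add: R4_def\<close>)
    have s2: "reach P xs 1 (?h + 1, R4) (?h + 2, R4)"
      by (rule reach_instr[OF ca(5)]) (use Suc.prems in \<open>simp add: R4_def\<close>)
    have m4: "map R4 (rs @ [t + 1, t + 2]) = env @ [i, r i]"
    proof -
      have "map R4 rs = map R rs"
        by (rule map_cong_below[OF Loop.prems(2)]) (use R3(5) in \<open>simp add: R4_def\<close>)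
      then show ?thesis using R3 by (simp add: env_def R4_def)
    qed
    have bb: "bnd W xs c (map R4 (rs @ [t + 1, t + 2]))"
      unfolding m4 using b(4) Suc.prems by simp
    have "\<forall>r\<in>set (rs @ [t + 1, t + 2]). r < t + 3" using Loop.prems(2) by auto
    from Loop.IH(3)[OF ca(6) this bb] obtain R5 where
      R5: "reach P xs (tcost W c) (?h + 2, R4) (?z, R5)"
        "R5 (t + 3) = r (Suc i)" "\<forall>r<t + 3. R5 r = R4 r"
      unfolding m4 by (auto simp: r_def)
    define R6 where "R6 = R5(t + 2 := r (Suc i))"
    define R7 where "R7 = R6(t + 3 := 1)"
    define R8 where "R8 = R7(t + 1 := Suc i)"
    have s3: "reach P xs 1 (?z, R5) (?z + 1, R6)"
      by (rule reach_instr[OF ca(7)]) (simp add: R6_def R5)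
    have s4: "reach P xs 1 (?z + 1, R6) (?z + 2, R7)"
      by (rule reach_instr[OF ca(8)]) (simp add: R7_def)
    have s5: "reach P xs 1 (?z + 2, R7) (?z + 3, R8)"
      by (rule reach_instr[OF ca(9)])
        (use R3 R5 in \<open>simp add: R8_def R7_def R6_def R4_def eval_nat_numeral\<close>)
    have s6: "reach P xs 1 (?z + 3, R8) (?h, R8)"
      by (rule reach_instr[OF ca(10)]) simp
    have "reach P xs (tcost W c + 6) (?h, R3) (?h, R8)"
      by (rule reach_trans[OF s1 reach_trans[OF s2 reach_trans[OF R5(1) reach_trans[OF s3
                reach_trans[OF s4 reach_trans[OF s5 s6 order.refl] order.refl] order.refl]
                order.refl] order.refl]]) simp
    from reach_trans[OF R3(1) this order.refl]
    have "reach P xs (tcost W a + tcost W b + 1 + Suc i * (tcost W c + 6)) (q, R) (?h, R8)"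
      by (rule reach_mono) simp
    moreover have "R8 t = n" "R8 (t + 1) = Suc i" "R8 (t + 2) = r (Suc i)" "\<forall>r<t. R8 r = R r"
      using R3 R5 by (auto simp: R8_def R7_def R6_def R4_def)
    ultimately show ?case by blast
  qed
  from lp[of n] obtain R3 where
    R3: "reach P xs (tcost W a + tcost W b + 1 + n * (tcost W c + 6)) (q, R) (?h, R3)"
       "R3 t = n" "R3 (t + 1) = n" "R3 (t + 2) = r n" "\<forall>r<t. R3 r = R r" by auto
  define R4 where "R4 = R3(t + 3 := 0)"
  have s1: "reach P xs 1 (?h, R3) (?h + 1, R4)"
    by (rule reach_instr[OF ca(4)]) (use R3 in \<open>simp add: R4_def\<close>)
  have s2: "reach P xs 1 (?h + 1, R4) (?z + 4, R4)"
    by (rule reach_instr[OF ca(5)]) (simp add: R4_def)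
  have s3: "reach P xs 1 (?z + 4, R4) (?z + 5, R4(t := r n))"
    by (rule reach_instr[OF ca(11)]) (use R3(4) in \<open>simp add: R4_def\<close>)
  have "n * (tcost W c + 6) \<le> W * (tcost W c + 6)" using b(3) by (rule mult_le_mono1)
  then have "reach P xs (tcost W (Loop a b c)) (q, R) (?z + 5, R4(t := r n))"
    by (intro reach_trans[OF R3(1) reach_trans[OF s1 reach_trans[OF s2 s3 order.refl] order.refl]])
      simp
  moreover have "?z + 5 = q + length (comp (Loop a b c) q rs t)" by (simp add: Let_def)
  moreover have "eval xs (Loop a b c) (map R rs) = r n"
    by (simp add: r_def n_def env_def)
  moreover have "\<forall>s<t. (R4(t := r n)) s = R s" using R3 by (auto simp: R4_def)
  ultimately show ?case by (metis fun_upd_same)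
qed

lemma eval_outputs_within:
  assumes "bnd W xs e []"
  shows "outputs_within (comp e 0 [] 0) xs (tcost W e) (eval xs e [])"
proof -
  let ?P = "comp e 0 [] 0"
  have "code_at ?P 0 ?P" by (auto simp: code_at_def)
  from comp_correct[OF this, of W xs "\<lambda>_. 0"] assms obtain R' where
    "reach ?P xs (tcost W e) (0, \<lambda>_. 0) (length ?P, R')" "R' 0 = eval xs e []" by auto
  then show ?thesis unfolding outputs_within_def reach_def run_def halted_def by force
qed

section \<open>Existence of loop bounds and polynomial cost\<close>

lemma bnd_mono: "bnd W xs e env \<Longrightarrow> W \<le> W' \<Longrightarrow> bnd W' xs e env"
  by (induction e arbitrary: env) (auto split: if_splits)

text \<open>Programs are total, so each single evaluation has some finite bound. This is enough for
  \<open>computable\<close>, which asks for no particular running time.\<close>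

lemma bnd_exists: "\<exists>W. bnd W xs e env"
proof (induction e arbitrary: env)
  case (Plus a b)
  then obtain W W' where "bnd W xs a env" "bnd W' xs b env" by blast
  then show ?case by (intro exI[of _ "W + W'"]) (auto intro: bnd_mono)
next
  case (Minus a b)
  then obtain W W' where "bnd W xs a env" "bnd W' xs b env" by blast
  then show ?case by (intro exI[of _ "W + W'"]) (auto intro: bnd_mono)
next
  case (Cond a b c)
  then obtain W W' W'' where "bnd W xs a env" "bnd W' xs b env" "bnd W'' xs c env" by metis
  then show ?case by (intro exI[of _ "W + W' + W''"]) (auto intro: bnd_mono)
next
  case (Bind a b)
  then obtain W W' where "bnd W xs a env" "bnd W' xs b (env @ [eval xs a env])" by metis
  then show ?case by (intro exI[of _ "W + W'"]) (auto intro: bnd_mono)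
next
  case (Loop a b c)
  obtain W W' where *: "bnd W xs a env" "bnd W' xs b env" using Loop by metis
  define g where "g i = env @ [i, rec_nat (eval xs b env) (\<lambda>i r. eval xs c (env @ [i, r])) i]" for i
  have "\<forall>i. \<exists>W. bnd W xs c (g i)" using Loop(3) by blast
  then obtain w where w: "\<And>i. bnd (w i) xs c (g i)" by metis
  let ?n = "eval xs a env"
  have "bnd (W + W' + ?n + (\<Sum>i<?n. w i)) xs c (g i)" if "i < ?n" for i
    by (rule bnd_mono[OF w]) (use that member_le_sum[of i "{..<?n}" w] in auto)
  then show ?case using *
    by (intro exI[of _ "W + W' + ?n + (\<Sum>i<?n. w i)"]) (auto simp: g_def intro: bnd_mono)
qed auto

lemma eval_computable: "computable (\<lambda>k. eval [k] e [])"
  unfolding computable_def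
proof (intro exI allI)
  fix k
  show "outputs_within (comp e 0 [] 0) [k] (tcost (SOME W. bnd W [k] e []) e) (eval [k] e [])"
    by (rule eval_outputs_within) (rule someI_ex[OF bnd_exists])
qed

text \<open>Only \<open>Loop\<close> multiplies by \<open>W\<close>; all else adds. Monomials
  suffice as bounds because \<open>1 \<le> W\<close> allows exponents to be raised when two of them
  are added.\<close>

lemma tcost_polynomial: "\<exists>K D. \<forall>W\<ge>1. tcost W e \<le> K * W ^ D"
proof (induction e)
  have poly_add: "\<exists>K D. \<forall>W\<ge>1. f W + g W + (c::nat) \<le> K * W ^ D"
    if fb: "\<exists>K D. \<forall>W\<ge>1. f W \<le> K * W ^ D" and gb: "\<exists>K D. \<forall>W\<ge>1. g W \<le> K * W ^ D" for f g :: "nat \<Rightarrow> nat" and c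
  proof -
    obtain K D where 1: "\<forall>W\<ge>1. f W \<le> K * W ^ D" using fb by blast
    obtain K' D' where 2: "\<forall>W\<ge>1. g W \<le> K' * W ^ D'" using gb by blast
    have "f W + g W + c \<le> (K + K' + c) * W ^ (D + D')" if "W \<ge> 1" for W
    proof -
      have "W ^ D \<le> W ^ (D + D')" "W ^ D' \<le> W ^ (D + D')" "1 \<le> W ^ (D + D')"
        using that by (auto intro: power_increasing one_le_power)
      then have "K * W ^ D \<le> K * W ^ (D + D')" "K' * W ^ D' \<le> K' * W ^ (D + D')"
        "c * 1 \<le> c * W ^ (D + D')" by (intro mult_le_mono2; simp)+
      then show ?thesis using 1[rule_format, OF that] 2[rule_format, OF that]
        unfolding distrib_right by linarith
    qed
    then show ?thesis by blast
  qed
  have poly_mult: "\<exists>K D. \<forall>W\<ge>1. W * f W \<le> K * W ^ D" if fb: "\<exists>K D. \<forall>W\<ge>1. f W \<le> K * W ^ D"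
    for f :: "nat \<Rightarrow> nat"
  proof -
    obtain K D where *: "\<forall>W\<ge>1. f W \<le> K * W ^ D" using fb by blast
    have "W * f W \<le> K * W ^ Suc D" if "W \<ge> 1" for W
      using mult_le_mono2[OF *[rule_format, OF that], of W] by (simp add: algebra_simps)
    then show ?thesis by blast
  qed
  have zero: "\<exists>K D. \<forall>W\<ge>1. (0::nat) \<le> K * W ^ D" by auto
  {
    case (Num x) show ?case by (rule exI[of _ 1], rule exI[of _ 0]) simp
  next
    case (Var x) show ?case by (rule exI[of _ 1], rule exI[of _ 0]) simp
  next
    case (Inp e) from poly_add[OF this zero, of 1] show ?case by simp
  next
    case (Plus a b) from poly_add[OF this, of 1] show ?case by simp
  next
    case (Minus a b) from poly_add[OF this, of 1] show ?case by simp
  next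
    case (Hlf e) from poly_add[OF this zero, of 1] show ?case by simp
  next
    case (Cond a b c)
    from poly_add[OF poly_add[OF Cond(1,2), of 0] Cond(3), of 2] show ?case by simp
  next
    case (Bind a b) from poly_add[OF this, of 1] show ?case by simp
  next
    case (Last k e) then show ?case by simp
  next
    case (Init e) then show ?case by simp
  next
    case (Loop a b c)
    from poly_add[OF poly_add[OF Loop(1,2), of 0] poly_mult[OF poly_add[OF Loop(3) zero, of 6]], of 4]
    show ?case by simp
  }
qed

section \<open>Adding a copy of a cluster\<close>

text \<open>\<open>E\<close> is meant to be reflexive: the instances \<open>u = v\<close> then state that the intervals are nonempty.\<close>

definition irep :: "'a set \<Rightarrow> ('a \<Rightarrow> 'a \<Rightarrow> bool) \<Rightarrow> nat \<Rightarrow> bool" where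
  "irep A E d \<longleftrightarrow> (\<exists>l r :: 'a \<Rightarrow> nat \<Rightarrow> real. \<forall>u\<in>A. \<forall>v\<in>A.
     E u v \<longleftrightarrow> (\<forall>i<d. l u i \<le> r v i \<and> l v i \<le> r u i))"

lemma irep_subset:
  assumes "irep A E d" "B \<subseteq> A"
  shows "irep B E d"
proof -
  obtain l r :: "'a \<Rightarrow> nat \<Rightarrow> real" where
    "\<forall>u\<in>A. \<forall>v\<in>A. E u v \<longleftrightarrow> (\<forall>i<d. l u i \<le> r v i \<and> l v i \<le> r u i)"
    using assms(1) unfolding irep_def by blast
  then have "\<forall>u\<in>B. \<forall>v\<in>B. E u v \<longleftrightarrow> (\<forall>i<d. l u i \<le> r v i \<and> l v i \<le> r u i)"
    using assms(2) by (meson subsetD)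
  then show ?thesis unfolding irep_def by blast
qed

text \<open>\<open>Y\<close> will hold all interval endpoints on one axis. Moving from
  \<open>p\<close> to \<open>q\<close> crosses none of them, whereas points of \<open>Y\<close>
  equal to \<open>p\<close> may be left behind.\<close>

lemma exists_close_between:
  fixes p p' :: real
  assumes "finite Y"
  shows "\<exists>q. (p = p' \<longrightarrow> q = p) \<and> (p < p' \<longrightarrow> p < q \<and> q < p') \<and> (p' < p \<longrightarrow> p' < q \<and> q < p) \<and>
    (\<forall>y\<in>Y. (y < p \<longrightarrow> y < q) \<and> (p < y \<longrightarrow> q < y))"
proof -
  consider "p = p'" | "p < p'" | "p' < p" by linarith
  then show ?thesis
  proof cases
    case 2
    let ?Z = "insert p' {y\<in>Y. p < y}"
    have fin: "finite ?Z" using assms by simp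
    have "p < Min ?Z" using fin 2 by (subst Min_gr_iff) auto
    then obtain q where q: "p < q" "q < Min ?Z" using dense by blast
    then have "\<forall>y\<in>?Z. q < y" using fin by (subst (asm) Min_gr_iff) auto
    then show ?thesis using q(1) 2 by (intro exI[of _ q]) auto
  next
    case 3
    let ?Z = "insert p' {y\<in>Y. y < p}"
    have fin: "finite ?Z" using assms by simp
    have "Max ?Z < p" using fin 3 by (subst Max_less_iff) auto
    then obtain q where q: "Max ?Z < q" "q < p" using dense by blast
    then have "\<forall>y\<in>?Z. y < q" using fin by (subst (asm) Max_less_iff) auto
    then show ?thesis using q(2) 3 by (intro exI[of _ q]) auto
  qed (auto intro!: exI[of _ p])
qed

text \<open>Among many copies \<open>\<phi> j ` B\<close> of the cluster \<open>B\<close>, two copies \<open>C, C'\<close> with common points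
  \<open>p, p'\<close> have the same position relative to the endpoints of the boxes of \<open>S\<close>. Within its cell,
  shrink every box of \<open>C\<close> towards \<open>p\<close>; then \<open>B\<close> can be placed like \<open>C\<close>, but with \<open>p\<close> moved
  slightly towards \<open>p'\<close>: whatever separates \<open>C\<close> from \<open>C'\<close> then separates \<open>C\<close> from \<open>B\<close>.\<close>

lemma irep_add_cluster_copy:
  fixes E :: "'a \<Rightarrow> 'a \<Rightarrow> bool" and \<phi> :: "'j \<Rightarrow> 'a \<Rightarrow> 'a"
  assumes fin: "finite A" "finite B" "finite J"
    and SA: "S \<subseteq> A" and BA: "B \<inter> A = {}"
    and sym: "\<And>u v. E u v \<longleftrightarrow> E v u"
    and phi: "\<And>j b. j \<in> J \<Longrightarrow> b \<in> B \<Longrightarrow> \<phi> j b \<in> A - S"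
    and clique: "\<And>j b b'. j \<in> J \<Longrightarrow> b \<in> B \<Longrightarrow> b' \<in> B \<Longrightarrow> E (\<phi> j b) (\<phi> j b')"
    and cliqueB: "\<And>b b'. b \<in> B \<Longrightarrow> b' \<in> B \<Longrightarrow> E b b'"
    and apart: "\<And>j j' b b'. j \<in> J \<Longrightarrow> j' \<in> J \<Longrightarrow> j \<noteq> j' \<Longrightarrow> b \<in> B \<Longrightarrow> b' \<in> B \<Longrightarrow> \<not> E (\<phi> j b) (\<phi> j' b')"
    and apart_other: "\<And>j b x. j \<in> J \<Longrightarrow> b \<in> B \<Longrightarrow> x \<in> A - S - \<phi> j ` B \<Longrightarrow> \<not> E (\<phi> j b) x"
    and apartB: "\<And>b x. b \<in> B \<Longrightarrow> x \<in> A - S \<Longrightarrow> \<not> E b x"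
    and Sadj: "\<And>j b s. j \<in> J \<Longrightarrow> b \<in> B \<Longrightarrow> s \<in> S \<Longrightarrow> E (\<phi> j b) s \<longleftrightarrow> E b s"
    and many: "2 ^ (2 * card B * d + 4 * card S * d) < card J"
    and rep: "irep A E d"
  shows "irep (A \<union> B) E d"
proof (cases "B = {}")
  case True
  then show ?thesis using rep by simp
next
  case False
  obtain l r :: "'a \<Rightarrow> nat \<Rightarrow> real" where lr:
    "\<And>u v. u \<in> A \<Longrightarrow> v \<in> A \<Longrightarrow> E u v \<longleftrightarrow> (\<forall>i<d. l u i \<le> r v i \<and> l v i \<le> r u i)"
    using rep unfolding irep_def by metis
  have finS: "finite S" using fin(1) SA finite_subset by blast
  \<comment> \<open>Pairwise meeting intervals on a line share their largest left endpoint.\<close>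
  define p where "p j i = Max ((\<lambda>b. l (\<phi> j b) i) ` B)" for j i
  have lp: "l (\<phi> j b) i \<le> p j i" if "b \<in> B" for j b i
    unfolding p_def using that fin(2) by (intro Max_ge) auto
  have rp: "p j i \<le> r (\<phi> j b) i" if "j \<in> J" "b \<in> B" "i < d" for j b i
    unfolding p_def using that fin(2) False clique[OF that(1)] lr phi[OF that(1)]
    by (subst Max_le_iff) auto
  define ep where "ep s i c = (if c then l s i else r s i)" for s i c
  \<comment> \<open>Between its left end and the common point, the interval of \<open>x\<close>
    contains an endpoint of \<open>S\<close>; shortening this side could alter an adjacency with
    \<open>S\<close>.\<close>
  define outL where "outL j x i \<longleftrightarrow> (\<exists>s\<in>S. \<exists>c. l x i \<le> ep s i c \<and> ep s i c \<le> p j i)" for j x i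
  define outR where "outR j x i \<longleftrightarrow> (\<exists>s\<in>S. \<exists>c. p j i \<le> ep s i c \<and> ep s i c \<le> r x i)" for j x i
  \<comment> \<open>The colour for the pigeonhole argument. Both comparisons with each endpoint are
    stored, so that an endpoint equal to \<open>p j i\<close> also equals \<open>p j' i\<close>, and
    then \<open>q i\<close> does not move off it. The sizes of the two components add up to the
    exponent in \<open>many\<close>.\<close>
  define pat where "pat j =
    ({(b, i, c). b \<in> B \<and> i < d \<and> (if c then outL j (\<phi> j b) i else outR j (\<phi> j b) i)},
     {(s, i, c, c'). s \<in> S \<and> i < d \<and> (if c' then ep s i c \<le> p j i else p j i \<le> ep s i c)})" for j
  let ?X = "B \<times> {..<d} \<times> {True, False}"
  let ?Y = "S \<times> {..<d} \<times> {True, False} \<times> {True, False}"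
  have patJ: "pat ` J \<subseteq> Pow ?X \<times> Pow ?Y" unfolding pat_def by auto
  have fXY: "finite (Pow ?X \<times> Pow ?Y)" using fin(2) finS by simp
  have cXY: "card (Pow ?X \<times> Pow ?Y) = 2 ^ (2 * card B * d + 4 * card S * d)"
  proof -
    have "card ?X = 2 * card B * d" "card ?Y = 4 * card S * d"
      using fin(2) finS by (simp_all add: card_cartesian_product)
    then show ?thesis using fin(2) finS
      by (simp only: card_cartesian_product card_Pow power_add finite_cartesian_product
          finite_lessThan finite.intros)
  qed
  have "card (pat ` J) < card J" using card_mono[OF fXY patJ] many cXY by linarith
  then have "\<not> inj_on pat J" using card_image by force
  then obtain j j' where jj: "j \<in> J" "j' \<in> J" "j \<noteq> j'" "pat j = pat j'"
    unfolding inj_on_def by blast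
  have outL: "outL j (\<phi> j b) i \<longleftrightarrow> outL j' (\<phi> j' b) i" if "b \<in> B" "i < d" for b i
  proof -
    have "(b, i, True) \<in> fst (pat j) \<longleftrightarrow> (b, i, True) \<in> fst (pat j')" using jj(4) by simp
    then show ?thesis using that unfolding pat_def by simp
  qed
  have outR: "outR j (\<phi> j b) i \<longleftrightarrow> outR j' (\<phi> j' b) i" if "b \<in> B" "i < d" for b i
  proof -
    have "(b, i, False) \<in> fst (pat j) \<longleftrightarrow> (b, i, False) \<in> fst (pat j')" using jj(4) by simp
    then show ?thesis using that unfolding pat_def by simp
  qed
  have cell: "ep s i c \<le> p j i \<longleftrightarrow> ep s i c \<le> p j' i" "p j i \<le> ep s i c \<longleftrightarrow> p j' i \<le> ep s i c"
    if "s \<in> S" "i < d" for s i c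
  proof -
    have "(s, i, c, c') \<in> snd (pat j) \<longleftrightarrow> (s, i, c, c') \<in> snd (pat j')" for c' using jj(4) by simp
    from this[of True] this[of False]
    show "ep s i c \<le> p j i \<longleftrightarrow> ep s i c \<le> p j' i" "p j i \<le> ep s i c \<longleftrightarrow> p j' i \<le> ep s i c"
      using that unfolding pat_def by simp_all
  qed
  define Q where "Q i q \<longleftrightarrow> (p j i = p j' i \<longrightarrow> q = p j i) \<and>
     (p j i < p j' i \<longrightarrow> p j i < q \<and> q < p j' i) \<and> (p j' i < p j i \<longrightarrow> p j' i < q \<and> q < p j i) \<and>
     (\<forall>y\<in>(\<lambda>x. l x i) ` A \<union> (\<lambda>x. r x i) ` A. (y < p j i \<longrightarrow> y < q) \<and> (p j i < y \<longrightarrow> q < y))" for i q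
  have "\<exists>q. Q i q" for i
    unfolding Q_def by (rule exists_close_between) (use fin(1) in auto)
  then obtain q where q: "\<And>i. Q i (q i)" by metis
  have qA: "(l x i < p j i \<longrightarrow> l x i < q i) \<and> (p j i < l x i \<longrightarrow> q i < l x i) \<and>
     (r x i < p j i \<longrightarrow> r x i < q i) \<and> (p j i < r x i \<longrightarrow> q i < r x i)" if "x \<in> A" for x i
    using q[of i] that unfolding Q_def by blast
  \<comment> \<open>\<open>q i\<close> lies between two points of the same cell, and cells are
    convex.\<close>
  have qcell: "ep s i c \<le> p j i \<longleftrightarrow> ep s i c \<le> q i" "p j i \<le> ep s i c \<longleftrightarrow> q i \<le> ep s i c"
    if "s \<in> S" "i < d" for s i c
    using cell[OF that, of c] q[of i] unfolding Q_def by linarith+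
  define C where "C = \<phi> j ` B"
  have CA: "C \<subseteq> A - S" using phi[OF jj(1)] by (auto simp: C_def)
  \<comment> \<open>\<open>z\<close> is the centre of the new interval: \<open>p j i\<close> for
    vertices of \<open>C\<close>, \<open>q i\<close> for those of \<open>B\<close>. A side that
    reaches no endpoint of \<open>S\<close> collapses to the centre.\<close>
  define nl where "nl x z i = (if outL j x i then l x i else z)" for x z i
  define nr where "nr x z i = (if outR j x i then r x i else z)" for x z i
  have nl_S: "nl x z i \<le> r s i \<longleftrightarrow> l x i \<le> r s i" and nr_S: "l s i \<le> nr x z i \<longleftrightarrow> l s i \<le> r x i"
    if "x \<in> C" "s \<in> S" "i < d" "z = p j i \<or> z = q i" for x z s i
  proof -
    have x: "l x i \<le> p j i" "p j i \<le> r x i" using lp rp jj(1) that by (auto simp: C_def)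
    note c = qcell[OF that(2,3), of True] qcell[OF that(2,3), of False]
    have "\<not> outL j x i \<Longrightarrow> \<not> (l x i \<le> r s i \<and> r s i \<le> p j i)"
      using that(2) unfolding outL_def ep_def by (metis (full_types))
    then show "nl x z i \<le> r s i \<longleftrightarrow> l x i \<le> r s i"
      using c x that(4) unfolding nl_def ep_def by auto
    have "\<not> outR j x i \<Longrightarrow> \<not> (p j i \<le> l s i \<and> l s i \<le> r x i)"
      using that(2) unfolding outR_def ep_def by (metis (full_types))
    then show "l s i \<le> nr x z i \<longleftrightarrow> l s i \<le> r x i"
      using c x that(4) unfolding nr_def ep_def by auto
  qed
  have contain: "nl x z i \<le> z" "z \<le> nr x z i"
    if "x \<in> C" "i < d" "z = p j i \<or> z = q i" for x z i
  proof -
    have x: "l x i \<le> p j i" "p j i \<le> r x i" using lp rp jj(1) that by (auto simp: C_def)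
    show "nl x z i \<le> z"
    proof (cases "outL j x i")
      case True
      then obtain s c where "s \<in> S" "l x i \<le> ep s i c" "ep s i c \<le> p j i"
        unfolding outL_def by blast
      then show ?thesis using qcell(1)[of s i c] that x by (auto simp: nl_def)
    qed (simp add: nl_def)
    show "z \<le> nr x z i"
    proof (cases "outR j x i")
      case True
      then obtain s c where "s \<in> S" "p j i \<le> ep s i c" "ep s i c \<le> r x i"
        unfolding outR_def by blast
      then show ?thesis using qcell(2)[of s i c] that x by (auto simp: nr_def)
    qed (simp add: nr_def)
  qed
  \<comment> \<open>Old gaps survive: collapsing a side to \<open>p j i\<close> can only widen them,
    and replacing \<open>p j i\<close> by \<open>q i\<close> crosses no endpoint of
    \<open>A\<close>.\<close>
  have far: "r y i < l x i \<Longrightarrow> r y i < nl x z i" "r x i < l y i \<Longrightarrow> nr x z i < l y i"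
    if "x \<in> C" "y \<in> A" "i < d" "z = p j i \<or> z = q i" for x y z i
  proof -
    have x: "l x i \<le> p j i" "p j i \<le> r x i" using lp rp jj(1) that by (auto simp: C_def)
    show "r y i < l x i \<Longrightarrow> r y i < nl x z i" "r x i < l y i \<Longrightarrow> nr x z i < l y i"
      using x qA[OF that(2), of i] that(4) unfolding nl_def nr_def by auto
  qed
  define bs where "bs u = (if u \<in> B then \<phi> j u else u)" for u
  define zz where "zz u i = (if u \<in> B then q i else p j i)" for u i
  define l' where "l' u i = (if u \<in> B \<union> C then nl (bs u) (zz u i) i else l u i)" for u i
  define r' where "r' u i = (if u \<in> B \<union> C then nr (bs u) (zz u i) i else r u i)" for u i
  define adj' where "adj' u v \<longleftrightarrow> (\<forall>i<d. l' u i \<le> r' v i \<and> l' v i \<le> r' u i)" for u v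
  have bsC: "bs u \<in> C" if "u \<in> B \<union> C" for u using that BA CA by (auto simp: bs_def C_def)
  have zzo: "zz u i = p j i \<or> zz u i = q i" for u i by (auto simp: zz_def)
  have notBC: "u \<notin> B \<union> C" if "u \<in> A - C" for u using that BA by auto
  have c1: "E u v \<longleftrightarrow> adj' u v" if "u \<in> A - C" "v \<in> A - C" for u v
    using that notBC lr by (auto simp: adj'_def l'_def r'_def)
  have c2: "E u v \<longleftrightarrow> adj' u v" if "u \<in> B \<union> C" "v \<in> S" for u v
  proof -
    have v: "v \<notin> B \<union> C" using that CA SA BA by auto
    have "E u v \<longleftrightarrow> E (bs u) v"
      using that Sadj[OF jj(1)] by (auto simp: bs_def)
    also have "\<dots> \<longleftrightarrow> (\<forall>i<d. l (bs u) i \<le> r v i \<and> l v i \<le> r (bs u) i)"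
      using lr bsC[OF that(1)] CA SA that(2) by auto
    also have "\<dots> \<longleftrightarrow> adj' u v"
      using nl_S[OF bsC[OF that(1)] that(2) _ zzo] nr_S[OF bsC[OF that(1)] that(2) _ zzo] v that(1)
      by (auto simp: adj'_def l'_def r'_def)
    finally show ?thesis .
  qed
  have c3: "E u v \<longleftrightarrow> adj' u v" if uv: "u \<in> B \<union> C" "v \<in> A - S - C" for u v
  proof -
    have v: "v \<notin> B \<union> C" using uv BA by auto
    have nb: "\<not> E (bs u) v"
      using bsC[OF uv(1)] apart_other[OF jj(1)] uv(2) by (auto simp: C_def)
    have nu: "\<not> E u v"
      using uv apartB apart_other[OF jj(1)] by (auto simp: C_def)
    from nb obtain i where i: "i < d" "\<not> (l (bs u) i \<le> r v i \<and> l v i \<le> r (bs u) i)"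
      using lr[of "bs u" v] bsC[OF uv(1)] CA uv(2) by auto
    then have "\<not> (l' u i \<le> r' v i \<and> l' v i \<le> r' u i)"
      using far[OF bsC[OF uv(1)] _ i(1) zzo, of v u] v uv by (auto simp: l'_def r'_def not_le)
    then show ?thesis using nu i(1) by (auto simp: adj'_def)
  qed
  have c4: "E u v \<longleftrightarrow> adj' u v" if "u \<in> B \<and> v \<in> B \<or> u \<in> C \<and> v \<in> C" for u v
  proof -
    have e: "E u v" using that cliqueB clique[OF jj(1)] by (auto simp: C_def)
    have uv: "u \<in> B \<union> C" "v \<in> B \<union> C" using that by auto
    have z: "zz u = zz v" using that BA CA unfolding zz_def by fastforce
    have "l' u i \<le> r' v i \<and> l' v i \<le> r' u i" if "i < d" for i
      using contain[OF bsC[OF uv(1)] that zzo, of u] contain[OF bsC[OF uv(2)] that zzo, of u] uv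
      unfolding l'_def r'_def z by simp
    then have "adj' u v" unfolding adj'_def by blast
    then show ?thesis using e by simp
  qed
  have c5: "E u v \<longleftrightarrow> adj' u v" if uv: "u \<in> B" "v \<in> C" for u v
  proof -
    have nE: "\<not> E u v" using apartB uv CA by auto
    obtain b where b: "b \<in> B" "v = \<phi> j b" using uv by (auto simp: C_def)
    have vB: "v \<notin> B" using uv CA BA by auto
    \<comment> \<open>A gap between \<open>C\<close> and the companion copy becomes a gap between
      \<open>C\<close> and \<open>B\<close> on the same axis.\<close>
    have "\<not> E (\<phi> j b) (\<phi> j' u)" using apart jj b uv by auto
    then obtain i where i: "i < d" "r v i < l (\<phi> j' u) i \<or> r (\<phi> j' u) i < l v i"
      using lr[of "\<phi> j b" "\<phi> j' u"] phi jj b uv by (auto simp: not_le)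
    have x: "l v i \<le> p j i" "p j i \<le> r v i" using lp rp jj(1) b i by auto
    have y: "l (\<phi> j' u) i \<le> p j' i" "p j' i \<le> r (\<phi> j' u) i" using lp rp jj(2) uv i by auto
    from i(2) have "\<not> (l' u i \<le> r' v i \<and> l' v i \<le> r' u i)"
    proof
      assume *: "r v i < l (\<phi> j' u) i"
      then have pp: "p j i < q i" "q i < p j' i" using x y q[of i] unfolding Q_def by auto
      \<comment> \<open>Such an endpoint would be at or above \<open>p j i\<close> but strictly
        below \<open>p j' i\<close>, against the equality of cells. By the mirrored argument and the
        equal patterns the facing side of \<open>u\<close> collapses too, so the two sides end at
        \<open>p j i\<close> and \<open>q i\<close>.\<close>
      have "\<not> outR j v i"
        unfolding outR_def
      proof clarify
        fix s c
        assume "s \<in> S" and "p j i \<le> ep s i c" "ep s i c \<le> r v i"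
        then show False using cell(2)[OF \<open>s \<in> S\<close> i(1), of c] * x y by linarith
      qed
      moreover have "\<not> outL j' (\<phi> j' u) i"
        unfolding outL_def
      proof clarify
        fix s c
        assume "s \<in> S" and "l (\<phi> j' u) i \<le> ep s i c" "ep s i c \<le> p j' i"
        then show False using cell(1)[OF \<open>s \<in> S\<close> i(1), of c] * x y by linarith
      qed
      then have "\<not> outL j (\<phi> j u) i" using outL uv i by blast
      ultimately have "r' v i = p j i" "l' u i = q i"
        using uv vB by (auto simp: r'_def l'_def nr_def nl_def bs_def zz_def)
      then show ?thesis using pp by simp
    next
      assume *: "r (\<phi> j' u) i < l v i"
      then have pp: "p j' i < q i" "q i < p j i" using x y q[of i] unfolding Q_def by auto
      have "\<not> outL j v i"
        unfolding outL_def
      proof clarify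
        fix s c
        assume "s \<in> S" and "l v i \<le> ep s i c" "ep s i c \<le> p j i"
        then show False using cell(1)[OF \<open>s \<in> S\<close> i(1), of c] * x y by linarith
      qed
      moreover have "\<not> outR j' (\<phi> j' u) i"
        unfolding outR_def
      proof clarify
        fix s c
        assume "s \<in> S" and "p j' i \<le> ep s i c" "ep s i c \<le> r (\<phi> j' u) i"
        then show False using cell(2)[OF \<open>s \<in> S\<close> i(1), of c] * x y by linarith
      qed
      then have "\<not> outR j (\<phi> j u) i" using outR uv i by blast
      ultimately have "l' v i = p j i" "r' u i = q i"
        using uv vB by (auto simp: r'_def l'_def nr_def nl_def bs_def zz_def)
      then show ?thesis using pp by simp
    qed
    then show ?thesis using nE i(1) by (auto simp: adj'_def)
  qed
  have sym': "adj' u v \<longleftrightarrow> adj' v u" for u v unfolding adj'_def by blast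
  have "E u v \<longleftrightarrow> adj' u v" if uv: "u \<in> A \<union> B" "v \<in> A \<union> B" for u v
  proof -
    have half: "E u v \<longleftrightarrow> adj' u v" if "u \<in> B \<union> C" "v \<in> A - C" for u v
      using c2[OF that(1)] c3[OF that(1)] that(2) by blast
    consider "u \<in> A - C" "v \<in> A - C" | "u \<in> B \<union> C" "v \<in> A - C" | "v \<in> B \<union> C" "u \<in> A - C"
      | "u \<in> B \<and> v \<in> B \<or> u \<in> C \<and> v \<in> C" | "u \<in> B" "v \<in> C" | "v \<in> B" "u \<in> C"
      using uv by blast
    then show ?thesis
      using c1 half c4 c5 sym[of u v] sym'[of u v] by cases blast+
  qed
  then show ?thesis unfolding irep_def adj'_def by blast
qed

text \<open>\<open>t\<close> need not be injective: vertices with the same image share a box. This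
  is how true twins are merged.\<close>

lemma irep_map:
  assumes "irep B E d" "\<And>v. v \<in> A \<Longrightarrow> t v \<in> B"
    and "\<And>u v. u \<in> A \<Longrightarrow> v \<in> A \<Longrightarrow> E u v \<longleftrightarrow> E (t u) (t v)"
  shows "irep A E d"
proof -
  obtain l r :: "'a \<Rightarrow> nat \<Rightarrow> real" where
    lr: "\<forall>u\<in>B. \<forall>v\<in>B. E u v \<longleftrightarrow> (\<forall>i<d. l u i \<le> r v i \<and> l v i \<le> r u i)"
    using assms(1) unfolding irep_def by blast
  have "\<forall>u\<in>A. \<forall>v\<in>A. E u v \<longleftrightarrow> (\<forall>i<d. (l \<circ> t) u i \<le> (r \<circ> t) v i \<and> (l \<circ> t) v i \<le> (r \<circ> t) u i)"
    using lr assms(2,3) by simp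
  then show ?thesis unfolding irep_def by blast
qed

text \<open>On each additional axis all vertices get the point 0.\<close>

lemma irep_mono:
  assumes "irep A E d" "d \<le> d'"
  shows "irep A E d'"
proof -
  obtain l r :: "'a \<Rightarrow> nat \<Rightarrow> real" where
    lr: "\<forall>u\<in>A. \<forall>v\<in>A. E u v \<longleftrightarrow> (\<forall>i<d. l u i \<le> r v i \<and> l v i \<le> r u i)"
    using assms(1) unfolding irep_def by blast
  define l' r' where "l' u i = (if i < d then l u i else 0)"
    and "r' u i = (if i < d then r u i else 0)" for u i
  have "(\<forall>i<d'. l' u i \<le> r' v i \<and> l' v i \<le> r' u i) \<longleftrightarrow> (\<forall>i<d. l u i \<le> r v i \<and> l v i \<le> r u i)" for u v
    using assms(2) unfolding l'_def r'_def by auto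
  with lr have "\<forall>u\<in>A. \<forall>v\<in>A. E u v \<longleftrightarrow> (\<forall>i<d'. l' u i \<le> r' v i \<and> l' v i \<le> r' u i)" by simp
  then show ?thesis unfolding irep_def by blast
qed

text \<open>Only the order of the endpoints on each axis matters, so each endpoint is replaced by
  the number of smaller ones on that axis. This makes the search for a representation
  finite.\<close>

lemma irep_bounded_nat:
  assumes fin: "finite A" and "irep A E d"
  shows "\<exists>l r :: 'a \<Rightarrow> nat \<Rightarrow> nat. (\<forall>u\<in>A. \<forall>i. l u i < 2 * card A \<and> r u i < 2 * card A) \<and>
    (\<forall>u\<in>A. \<forall>v\<in>A. E u v \<longleftrightarrow> (\<forall>i<d. l u i \<le> r v i \<and> l v i \<le> r u i))"
proof -
  obtain l r :: "'a \<Rightarrow> nat \<Rightarrow> real" where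
    lr: "\<forall>u\<in>A. \<forall>v\<in>A. E u v \<longleftrightarrow> (\<forall>i<d. l u i \<le> r v i \<and> l v i \<le> r u i)"
    using assms(2) unfolding irep_def by blast
  define Y where "Y i = (\<lambda>u. l u i) ` A \<union> (\<lambda>u. r u i) ` A" for i
  define f where "f i x = card {y \<in> Y i. y < x}" for i x
  have finY: "finite (Y i)" for i using fin by (simp add: Y_def)
  have cY: "card (Y i) \<le> 2 * card A" for i
    unfolding Y_def using card_Un_le[of "(\<lambda>u. l u i) ` A" "(\<lambda>u. r u i) ` A"]
      card_image_le[OF fin, of "\<lambda>u. l u i"] card_image_le[OF fin, of "\<lambda>u. r u i"] by linarith
  have less: "f i x < 2 * card A" if "x \<in> Y i" for i x
    using psubset_card_mono[OF finY[of i], of "{y \<in> Y i. y < x}"] that cY[of i]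
    unfolding f_def by fastforce
  have mono: "f i x < f i y" if "x \<in> Y i" "x < y" for i x y
    unfolding f_def by (rule psubset_card_mono) (use finY[of i] that in auto)
  have le: "x \<le> y \<longleftrightarrow> f i x \<le> f i y" if "x \<in> Y i" "y \<in> Y i" for i x y
    using mono[OF that(1), of y] mono[OF that(2), of x] by (cases x y rule: linorder_cases) auto
  have inY: "l u i \<in> Y i" "r u i \<in> Y i" if "u \<in> A" for u i using that by (auto simp: Y_def)
  have "E u v \<longleftrightarrow> (\<forall>i<d. f i (l u i) \<le> f i (r v i) \<and> f i (l v i) \<le> f i (r u i))" if "u \<in> A" "v \<in> A" for u v
    using lr that le[OF inY(1)[OF that(1)] inY(2)[OF that(2)]] le[OF inY(1)[OF that(2)] inY(2)[OF that(1)]]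
    by simp
  then show ?thesis
    by (intro exI[of _ "\<lambda>u i. f i (l u i)"] exI[of _ "\<lambda>u i. f i (r u i)"])
      (use less inY in simp)
qed

section \<open>Reduction to a bounded number of vertices\<close>

locale cluster_modulator =
  fixes n :: nat and E :: "nat \<Rightarrow> nat \<Rightarrow> bool" and S :: "nat set"
  assumes sym: "E u v \<longleftrightarrow> E v u"
    and refl: "E v v"
    and S_sub: "S \<subseteq> {..<n}"
    and trans: "\<lbrakk>u \<in> {..<n} - S; v \<in> {..<n} - S; w \<in> {..<n} - S; E u v; E v w\<rbrakk> \<Longrightarrow> E u w"
begin

definition U where "U = {..<n} - S"
definition same_type where "same_type u v \<longleftrightarrow> (\<forall>w\<in>S. E u w \<longleftrightarrow> E v w)"
definition nbh where "nbh v = {w\<in>S. E v w}"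
definition types where "types v = nbh ` {x\<in>U. E x v}"
text \<open>A cluster is represented by its least vertex, so that counting clusters becomes counting
  vertices, which a bounded loop can do.\<close>

definition leader where "leader c \<longleftrightarrow> c \<in> U \<and> \<not> (\<exists>u<c. u \<in> U \<and> E u c)"
text \<open>Only smaller twins are excluded: in \<open>U\<close> this selects the least vertex of
  each class of true twins.\<close>

definition twin_free where "twin_free v \<longleftrightarrow> \<not> (\<exists>u<v. u \<in> U \<and> E u v \<and> same_type u v)"
definition earlier where "earlier c = {c'. c' < c \<and> leader c' \<and> types c = types c'}"
text \<open>Of each class of equivalent clusters, those with the \<open>N + 1\<close> smallest
  leaders remain. This is decided for each vertex on its own, without simulating successive
  deletions.\<close>

definition kept where
  "kept N v \<longleftrightarrow> v < n \<and> (v \<in> S \<or> twin_free v \<and> (\<exists>c. leader c \<and> E c v \<and> card (earlier c) \<le> N))"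

lemma finS: "finite S" using S_sub finite_subset by blast
lemma finU: "finite U" by (simp add: U_def)

lemma transU: "u \<in> U \<Longrightarrow> v \<in> U \<Longrightarrow> w \<in> U \<Longrightarrow> E u v \<Longrightarrow> E v w \<Longrightarrow> E u w"
  unfolding U_def using trans by blast

lemma same_type_iff: "same_type u v \<longleftrightarrow> nbh u = nbh v"
  unfolding same_type_def nbh_def by blast

lemma leader_unique: "leader c \<Longrightarrow> leader c' \<Longrightarrow> E c c' \<Longrightarrow> c = c'"
  unfolding leader_def using sym by (metis linorder_neqE_nat)

lemma leader_exists:
  assumes "v \<in> U"
  shows "\<exists>c. leader c \<and> E c v"
proof -
  let ?P = "\<lambda>c. c \<in> U \<and> E c v"
  have P: "?P (LEAST c. ?P c)" by (rule LeastI[of ?P v]) (use assms refl in auto)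
  moreover have "\<not> ?P u" if "u < (LEAST c. ?P c)" for u using not_less_Least that by blast
  ultimately have "leader (LEAST c. ?P c)" unfolding leader_def using transU assms by blast
  then show ?thesis using P by blast
qed

lemma twin_free_exists:
  assumes "v \<in> U"
  shows "\<exists>u. u \<in> U \<and> twin_free u \<and> E u v \<and> nbh u = nbh v"
proof -
  let ?P = "\<lambda>c. c \<in> U \<and> E c v \<and> nbh c = nbh v"
  have P: "?P (LEAST c. ?P c)" by (rule LeastI[of ?P v]) (use assms refl in auto)
  moreover have "\<not> ?P u" if "u < (LEAST c. ?P c)" for u using not_less_Least that by blast
  ultimately have "twin_free (LEAST c. ?P c)"
    unfolding twin_free_def same_type_iff using transU assms by (metis (no_types, lifting))
  then show ?thesis using P by blast
qed

lemma twin_free_unique: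
  "\<lbrakk>u \<in> U; v \<in> U; twin_free u; twin_free v; E u v; nbh u = nbh v\<rbrakk> \<Longrightarrow> u = v"
  unfolding twin_free_def same_type_iff using sym by (metis linorder_neqE_nat)

lemma irep_twin_free:
  assumes "irep (S \<union> {v\<in>U. twin_free v}) E d"
  shows "irep {..<n} E d"
proof -
  define t where
    "t v = (if v \<in> S then v else SOME u. u \<in> U \<and> twin_free u \<and> E u v \<and> nbh u = nbh v)" for v
  have t: "t v \<in> U \<and> twin_free (t v) \<and> E (t v) v \<and> nbh (t v) = nbh v" if "v \<in> U" for v
    using someI_ex[OF twin_free_exists[OF that]] that by (simp add: t_def U_def)
  have tS: "t v = v" if "v \<in> S" for v using that by (simp add: t_def)
  have US: "E u v \<longleftrightarrow> E (t u) (t v)" if "u \<in> U" "v \<in> S" for u v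
    using t[OF that(1)] that(2) tS[OF that(2)] unfolding nbh_def by auto
  have V: "{..<n} = S \<union> U" using S_sub by (auto simp: U_def)
  show ?thesis
  proof (rule irep_map[OF assms, of _ t])
    fix v assume "v \<in> {..<n}"
    then show "t v \<in> S \<union> {v\<in>U. twin_free v}" using t tS V by auto
  next
    fix u v assume "u \<in> {..<n}" "v \<in> {..<n}"
    then consider "u \<in> S" "v \<in> S" | "u \<in> U" "v \<in> S" | "u \<in> S" "v \<in> U" | "u \<in> U" "v \<in> U"
      using V by blast
    then show "E u v \<longleftrightarrow> E (t u) (t v)"
    proof cases
      case 3
      then show ?thesis using US[of v u] sym by blast
    next
      case 4
      then show ?thesis using t[of u] t[of v] transU sym by metis
    qed (auto simp: tS US)
  qed
qed

text \<open>Interpolates between the kept graph and the graph with all twins merged: only clusters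
  with a leader in \<open>X\<close> are present.\<close>

definition restr where "restr X = S \<union> {v\<in>U. twin_free v \<and> (\<exists>c\<in>X. E c v)}"

text \<open>The clusters of \<open>earlier c\<close> serve as copies: equality of
  \<open>types\<close> gives each representative in the cluster of \<open>c\<close> a counterpart
  with the same neighbourhood in \<open>S\<close> in each of them. They must all be present already,
  hence the assumption \<open>J\<close>.\<close>

lemma irep_restr_insert:
  assumes X: "X \<subseteq> {c. leader c}" and c: "leader c" "c \<notin> X" and J: "earlier c \<subseteq> X"
    and many: "2 ^ ((2 * 2 ^ card S + 4 * card S) * d) < card (earlier c)"
    and rep: "irep (restr X) E d"
  shows "irep (restr (insert c X)) E d"
proof -
  define B where "B = {v\<in>U. twin_free v \<and> E c v}"
  define \<phi> where "\<phi> j b = (SOME y. y \<in> U \<and> twin_free y \<and> E j y \<and> nbh y = nbh b)" for j b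
  have LU: "\<And>j. leader j \<Longrightarrow> j \<in> U" by (simp add: leader_def)
  have jl: "j \<in> U \<and> leader j \<and> types c = types j \<and> j \<noteq> c" if "j \<in> earlier c" for j
    using that by (auto simp: earlier_def leader_def)
  have phi: "\<phi> j b \<in> U \<and> twin_free (\<phi> j b) \<and> E j (\<phi> j b) \<and> nbh (\<phi> j b) = nbh b"
    if j: "j \<in> earlier c" and b: "b \<in> B" for j b
  proof -
    have "nbh b \<in> types c" using b sym by (auto simp: types_def B_def)
    then have "nbh b \<in> types j" using jl[OF j] by simp
    then obtain x where x: "x \<in> U" "E x j" "nbh x = nbh b" by (auto simp: types_def)
    obtain y where "y \<in> U" "twin_free y" "E y x" "nbh y = nbh x"
      using twin_free_exists[OF x(1)] by blast
    then have "\<exists>y. y \<in> U \<and> twin_free y \<and> E j y \<and> nbh y = nbh b"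
      using x jl[OF j] transU sym by metis
    then show ?thesis unfolding \<phi>_def by (rule someI_ex)
  qed
  have leadE: "c1 = c2" if "leader c1" "leader c2" "x \<in> U" "y \<in> U" "E c1 x" "E c2 y" "E x y" for c1 c2 x y
    using that leader_unique LU transU sym by metis
  have "irep (restr X \<union> B) E d"
  proof (rule irep_add_cluster_copy[where S = S and J = "earlier c" and \<phi> = \<phi>])
    have "restr X \<union> B \<subseteq> S \<union> U" by (auto simp: restr_def B_def)
    then show "finite (restr X)" "finite B" using finS finU finite_subset by auto
    show "finite (earlier c)" by (auto simp: earlier_def)
    show "S \<subseteq> restr X" by (auto simp: restr_def)
    show "B \<inter> restr X = {}"
    proof (rule ccontr)
      assume "B \<inter> restr X \<noteq> {}"
      then obtain v c' where v: "v \<in> U" "E c v" "c' \<in> X" "E c' v"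
        by (auto simp: restr_def B_def U_def)
      then have "c = c'" using leadE[of c c' v v] c(1) X refl by auto
      then show False using v c by simp
    qed
    show "E u v \<longleftrightarrow> E v u" for u v by (rule sym)
    show "\<phi> j b \<in> restr X - S" if "j \<in> earlier c" "b \<in> B" for j b
      using phi[OF that] that J by (auto simp: restr_def U_def)
    show "E (\<phi> j b) (\<phi> j b')" if "j \<in> earlier c" "b \<in> B" "b' \<in> B" for j b b'
      using phi[OF that(1,2)] phi[OF that(1,3)] jl[OF that(1)] transU sym by metis
    show "E b b'" if "b \<in> B" "b' \<in> B" for b b'
      using that LU[OF c(1)] transU[of b c b'] sym by (auto simp: B_def)
    show "\<not> E (\<phi> j b) (\<phi> j' b')" if "j \<in> earlier c" "j' \<in> earlier c" "j \<noteq> j'" "b \<in> B" "b' \<in> B" for j j' b b'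
      using phi[OF that(1,4)] phi[OF that(2,5)] jl[OF that(1)] jl[OF that(2)] leadE that(3) by blast
    \<comment> \<open>Here the other inclusion between \<open>types\<close> enters: every
      representative in the cluster of \<open>j\<close> is a value of
      \<open>\<phi> j\<close>.\<close>
    show "\<not> E (\<phi> j b) x" if j: "j \<in> earlier c" and b: "b \<in> B" and x: "x \<in> restr X - S - \<phi> j ` B" for j b x
    proof
      assume e: "E (\<phi> j b) x"
      have xU: "x \<in> U" "twin_free x" using x by (auto simp: restr_def)
      have jx: "E j x" using e phi[OF j b] xU jl[OF j] transU by blast
      then have "nbh x \<in> types j" using xU sym by (auto simp: types_def)
      then have "nbh x \<in> types c" using jl[OF j] by simp
      then obtain x' where x': "x' \<in> U" "E x' c" "nbh x' = nbh x" by (auto simp: types_def)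
      obtain b' where b': "b' \<in> U" "twin_free b'" "E b' x'" "nbh b' = nbh x'"
        using twin_free_exists[OF x'(1)] by blast
      then have "b' \<in> B" using x' LU[OF c(1)] transU sym unfolding B_def by blast
      with phi[OF j this] have "\<phi> j b' = x"
        using twin_free_unique[OF _ xU(1) _ xU(2)] jx jl[OF j] transU sym b' x' xU by metis
      then show False using x \<open>b' \<in> B\<close> by auto
    qed
    show "\<not> E b x" if b: "b \<in> B" and x: "x \<in> restr X - S" for b x
    proof
      assume e: "E b x"
      obtain c' where c': "c' \<in> X" "E c' x" "x \<in> U" using x by (auto simp: restr_def)
      have "c = c'" using leadE[of c c' b x] c' b e c X by (auto simp: B_def)
      then show False using c' c by simp
    qed
    show "E (\<phi> j b) s \<longleftrightarrow> E b s" if "j \<in> earlier c" "b \<in> B" "s \<in> S" for j b s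
      using phi[OF that(1,2)] that(3) by (auto simp: nbh_def)
    \<comment> \<open>With twins merged, the vertices of one cluster differ in their neighbourhoods
      in \<open>S\<close>; this is the origin of the summand \<open>2 * 2 ^ card S\<close>.\<close>
    have "inj_on nbh B"
      unfolding inj_on_def B_def using twin_free_unique LU[OF c(1)] transU sym by (metis (no_types, lifting) mem_Collect_eq)
    moreover have "nbh ` B \<subseteq> Pow S" by (auto simp: nbh_def)
    ultimately have "card B \<le> card (Pow S)" using card_inj_on_le finS by blast
    then have "card B \<le> 2 ^ card S" by (simp add: card_Pow finS)
    then have "2 * card B * d + 4 * card S * d \<le> (2 * 2 ^ card S + 4 * card S) * d"
      by (simp add: distrib_right)
    then have "(2::nat) ^ (2 * card B * d + 4 * card S * d) \<le> 2 ^ ((2 * 2 ^ card S + 4 * card S) * d)"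
      by (intro power_increasing) auto
    then show "2 ^ (2 * card B * d + 4 * card S * d) < card (earlier c)" using many by linarith
  qed (rule rep)
  moreover have "restr X \<union> B = restr (insert c X)" by (auto simp: restr_def B_def)
  ultimately show ?thesis by simp
qed

text \<open>Deleted clusters return in increasing order of their leaders. When the turn of
  \<open>c\<close> comes, all of \<open>earlier c\<close> is present, and it has more than
  \<open>N\<close> elements.\<close>

theorem irep_kept:
  assumes N: "2 ^ ((2 * 2 ^ card S + 4 * card S) * d) \<le> N"
  shows "irep {v. kept N v} E d \<longleftrightarrow> irep {..<n} E d"
proof
  assume "irep {..<n} E d"
  then show "irep {v. kept N v} E d" by (rule irep_subset) (auto simp: kept_def)
next
  assume a: "irep {v. kept N v} E d"
  let ?L = "{c. leader c}"
  let ?K = "{c. leader c \<and> card (earlier c) \<le> N}"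
  have finL: "finite ?L" by (rule finite_subset[OF _ finU]) (auto simp: leader_def)
  have K: "{v. kept N v} = restr ?K"
    using S_sub by (auto simp: kept_def restr_def U_def)
  have "irep (restr ?L) E d" if "?K \<subseteq> X" "X \<subseteq> ?L" "irep (restr X) E d" for X
    using that
  proof (induction "card (?L - X)" arbitrary: X)
    case 0
    then have "X = ?L" using finL by auto
    then show ?case using 0 by simp
  next
    case (Suc k)
    then have ne: "?L - X \<noteq> {}" by auto
    define c where "c = (LEAST c. c \<in> ?L - X)"
    have c: "c \<in> ?L - X" unfolding c_def using ne by (metis (mono_tags) LeastI ex_in_conv)
    have J: "earlier c \<subseteq> X"
    proof
      fix j assume "j \<in> earlier c"
      then have "j < c" "leader j" by (auto simp: earlier_def)
      then show "j \<in> X" using not_less_Least[of j "\<lambda>c. c \<in> ?L - X"] unfolding c_def by blast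
    qed
    have "\<not> card (earlier c) \<le> N" using c Suc.prems(1) by auto
    then have "irep (restr (insert c X)) E d"
      using irep_restr_insert[OF Suc.prems(2) _ _ J _ Suc.prems(3)] c N by auto
    moreover have "card (?L - insert c X) = k"
    proof -
      have "?L - insert c X = (?L - X) - {c}" by blast
      then show ?thesis using Suc(2) c by (metis card_Diff_singleton diff_Suc_1)
    qed
    ultimately show ?case using Suc.hyps(1)[of "insert c X"] Suc.prems c by auto
  qed
  from this[of ?K] a have "irep (restr ?L) E d" unfolding K by auto
  moreover have "restr ?L = S \<union> {v\<in>U. twin_free v}"
    unfolding restr_def using leader_exists by blast
  ultimately show "irep {..<n} E d" using irep_twin_free by simp
qed

text \<open>A kept vertex outside \<open>S\<close> is determined by the class of its cluster, the
  position of the cluster within the class, and its own neighbourhood in \<open>S\<close>; the three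
  factors count these.\<close>

lemma card_kept:
  "card {v. kept N v} \<le> card S + 2 ^ (2 ^ card S) * (Suc N * 2 ^ card S)"
proof -
  let ?K = "{v\<in>U. kept N v}"
  define g where "g v = (types v, card (earlier (SOME c. leader c \<and> E c v)), nbh v)" for v
  have ld: "leader (SOME c. leader c \<and> E c v) \<and> E (SOME c. leader c \<and> E c v) v" if "v \<in> U" for v
    using someI_ex[OF leader_exists[OF that]] .
  have ldu: "(SOME c. leader c \<and> E c v) = c" if "v \<in> U" "leader c" "E c v" for v c
  proof -
    have "E (SOME c. leader c \<and> E c v) c"
      using transU[of _ v c] ld[OF that(1)] that sym[of v c] unfolding leader_def by blast
    then show ?thesis using leader_unique ld[OF that(1)] that(2) by blast
  qed
  have ty: "types v = types c" if "v \<in> U" "c \<in> U" "E c v" for v c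
  proof -
    have "{x\<in>U. E x v} = {x\<in>U. E x c}" using that transU sym by blast
    then show ?thesis by (simp add: types_def)
  qed
  have "inj_on g ?K"
  proof (rule inj_onI)
    fix u v assume uv: "u \<in> ?K" "v \<in> ?K" "g u = g v"
    then obtain c c' where c: "leader c" "E c u" "leader c'" "E c' v"
      by (auto simp: kept_def U_def)
    have cU: "c \<in> U" "c' \<in> U" using c by (auto simp: leader_def)
    have tcc: "types c = types c'" using uv ty cU c by (auto simp: g_def)
    have cc: "card (earlier c) = card (earlier c')"
      using uv ldu[of u c] ldu[of v c'] c by (auto simp: g_def)
    have mono: "card (earlier a) < card (earlier b)" if "a < b" "leader a" "types a = types b" for a b
      by (rule psubset_card_mono) (use that in \<open>auto simp: earlier_def\<close>)
    have "c = c'" using mono[of c c'] mono[of c' c] tcc cc c by (metis linorder_neqE_nat less_irrefl)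
    then have "E u v" using c uv cU transU sym by blast
    then show "u = v" using twin_free_unique uv by (auto simp: g_def kept_def U_def)
  qed
  moreover have "g ` ?K \<subseteq> Pow (Pow S) \<times> {..N} \<times> Pow S"
  proof -
    have "card (earlier (SOME c. leader c \<and> E c v)) \<le> N" if vK: "v \<in> ?K" for v
    proof -
      obtain c where "leader c" "E c v" "card (earlier c) \<le> N"
        using vK by (auto simp: kept_def U_def)
      then show ?thesis using ldu[of v c] vK by auto
    qed
    then show ?thesis by (auto simp: g_def types_def nbh_def)
  qed
  moreover have "finite (Pow (Pow S) \<times> {..N} \<times> Pow S)" using finS by simp
  ultimately have "card ?K \<le> card (Pow (Pow S) \<times> {..N} \<times> Pow S)" by (rule card_inj_on_le)
  also have "\<dots> = 2 ^ (2 ^ card S) * (Suc N * 2 ^ card S)"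
    using finS by (simp add: card_cartesian_product card_Pow)
  finally have "card ?K \<le> 2 ^ (2 ^ card S) * (Suc N * 2 ^ card S)" .
  moreover have "{v. kept N v} \<subseteq> S \<union> ?K" by (auto simp: kept_def U_def)
  then have "card {v. kept N v} \<le> card (S \<union> ?K)" using finS finU by (intro card_mono) auto
  moreover have "card (S \<union> ?K) \<le> card S + card ?K" by (rule card_Un_le)
  ultimately show ?thesis by linarith
qed

text \<open>One axis for each \<open>s\<close> in \<open>S\<close>: \<open>s\<close> gets the point
  0, its neighbours the interval from 0 to 1, all others the point 1, so exactly the non-neighbours
  miss \<open>s\<close>. On the last axis every cluster is the point given by its leader, and each
  vertex of \<open>S\<close> spans all of them.\<close>

lemma irep_card_modulator: "irep {..<n} E (card S + 1)"
proof -
  obtain e where e: "bij_betw e {..<card S} S"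
    using ex_bij_betw_nat_finite[OF finS] by (auto simp: atLeast0LessThan)
  define c where "c v = (SOME c. leader c \<and> E c v)" for v
  have ld: "leader (c v) \<and> E (c v) v" if "v \<in> U" for v
    unfolding c_def using someI_ex[OF leader_exists[OF that]] .
  have cn: "c v < n" if "v \<in> U" for v using ld[OF that] by (auto simp: leader_def U_def)
  have cE: "E u v \<longleftrightarrow> c u = c v" if "u \<in> U" "v \<in> U" for u v
  proof
    assume "E u v"
    then have "E (c u) v" using transU[of "c u" u v] ld[OF that(1)] that unfolding leader_def by blast
    then have "E (c u) (c v)"
      using transU[of "c u" v "c v"] ld[OF that(1)] ld[OF that(2)] that sym[of v "c v"]
      unfolding leader_def by blast
    then show "c u = c v" using leader_unique ld[OF that(1)] ld[OF that(2)] by blast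
  next
    assume "c u = c v"
    then show "E u v"
      using transU[of u "c u" v] ld[OF that(1)] ld[OF that(2)] that sym[of u "c u"]
      unfolding leader_def by metis
  qed
  define l :: "nat \<Rightarrow> nat \<Rightarrow> real" where
    "l v i = (if i < card S then (if E v (e i) then 0 else 1) else if v \<in> S then 0 else c v)" for v i
  define r :: "nat \<Rightarrow> nat \<Rightarrow> real" where
    "r v i = (if i < card S then (if v = e i then 0 else 1) else if v \<in> S then n else c v)" for v i
  have "E u v \<longleftrightarrow> (\<forall>i<card S + 1. l u i \<le> r v i \<and> l v i \<le> r u i)" if uv: "u < n" "v < n" for u v
  proof
    assume E: "E u v"
    show "\<forall>i<card S + 1. l u i \<le> r v i \<and> l v i \<le> r u i"
    proof (intro allI impI)
      fix i assume "i < card S + 1"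
      then consider "i < card S" | "i = card S" by linarith
      then show "l u i \<le> r v i \<and> l v i \<le> r u i"
      proof cases
        case 1
        then show ?thesis using E sym by (auto simp: l_def r_def)
      next
        case 2
        then show ?thesis using E cE[of u v] cn[of u] cn[of v] uv
          by (auto simp: l_def r_def U_def)
      qed
    qed
  next
    assume a: "\<forall>i<card S + 1. l u i \<le> r v i \<and> l v i \<le> r u i"
    show "E u v"
    proof (rule ccontr)
      assume nE: "\<not> E u v"
      then have nE': "\<not> E v u" using sym by blast
      have ex: "\<exists>i<card S. e i = s" if "s \<in> S" for s
        using e that by (metis bij_betw_iff_bijections lessThan_iff)
      consider "u \<in> S" | "v \<in> S" | "u \<in> U" "v \<in> U" using uv by (auto simp: U_def)
      then show False
      proof cases
        case 1
        then obtain i where "i < card S" "e i = u" using ex by blast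
        then have "l v i = 1" "r u i = 0" using nE' by (auto simp: l_def r_def)
        then show False using a \<open>i < card S\<close> by (metis less_add_one less_trans not_one_le_zero)
      next
        case 2
        then obtain i where "i < card S" "e i = v" using ex by blast
        then have "l u i = 1" "r v i = 0" using nE by (auto simp: l_def r_def)
        then show False using a \<open>i < card S\<close> by (metis less_add_one less_trans not_one_le_zero)
      next
        case 3
        then have "c u = c v" using a[rule_format, of "card S"] by (auto simp: l_def r_def U_def)
        then show False using nE cE[OF 3] by simp
      qed
    qed
  qed
  then show ?thesis unfolding irep_def by (intro exI[of _ l] exI[of _ r]) auto
qed

end

section \<open>Boxicity and cluster vertex deletion\<close>

abbreviation radj :: "('a, 'b) pre_digraph \<Rightarrow> 'a \<Rightarrow> 'a \<Rightarrow> bool" where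
  "radj G u v \<equiv> u = v \<or> u \<rightarrow>\<^bsub>G\<^esub> v"

lemma PiE_intervals_meet:
  fixes l r l' r' :: "nat \<Rightarrow> real"
  assumes "\<forall>i<d. l i \<le> r i" "\<forall>i<d. l' i \<le> r' i"
  shows "(\<Pi>\<^sub>E i\<in>{..<d}. {l i..r i}) \<inter> (\<Pi>\<^sub>E i\<in>{..<d}. {l' i..r' i}) \<noteq> {} \<longleftrightarrow>
    (\<forall>i<d. l i \<le> r' i \<and> l' i \<le> r i)"
proof -
  have "(\<Pi>\<^sub>E i\<in>{..<d}. {l i..r i}) \<inter> (\<Pi>\<^sub>E i\<in>{..<d}. {l' i..r' i}) =
      (\<Pi>\<^sub>E i\<in>{..<d}. {max (l i) (l' i)..min (r i) (r' i)})"
    unfolding PiE_Int by simp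
  then show ?thesis using assms by (auto simp: PiE_eq_empty_iff)
qed

lemma box_representation_iff_irep:
  "(\<exists>B. box_representation G d B) \<longleftrightarrow> irep (verts G) (radj G) d"
proof
  assume "\<exists>B. box_representation G d B"
  then obtain B where B: "\<And>v. v \<in> verts G \<Longrightarrow> is_box d (B v)"
    "\<And>u v. u \<in> verts G \<Longrightarrow> v \<in> verts G \<Longrightarrow> u \<noteq> v \<Longrightarrow> u \<rightarrow>\<^bsub>G\<^esub> v \<longleftrightarrow> B u \<inter> B v \<noteq> {}"
    unfolding box_representation_def by blast
  have "\<forall>v. \<exists>l r. v \<in> verts G \<longrightarrow> (\<forall>i<d. l i \<le> r i) \<and> B v = (\<Pi>\<^sub>E i\<in>{..<d}. {l i..r i})"
    using B(1) unfolding is_box_def by blast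
  then obtain l r where lr: "\<And>v. v \<in> verts G \<Longrightarrow> \<forall>i<d. l v i \<le> r v i"
    "\<And>v. v \<in> verts G \<Longrightarrow> B v = (\<Pi>\<^sub>E i\<in>{..<d}. {l v i..r v i})" by metis
  have "radj G u v \<longleftrightarrow> (\<forall>i<d. l u i \<le> r v i \<and> l v i \<le> r u i)"
    if "u \<in> verts G" "v \<in> verts G" for u v
    using B(2)[OF that] PiE_intervals_meet[OF lr(1)[OF that(1)] lr(1)[OF that(2)]] lr(1)[OF that(1)]
    by (cases "u = v") (simp_all add: lr(2) that)
  then show "irep (verts G) (radj G) d" unfolding irep_def by blast
next
  assume "irep (verts G) (radj G) d"
  then obtain l r :: "'a \<Rightarrow> nat \<Rightarrow> real" where
    lr: "\<forall>u\<in>verts G. \<forall>v\<in>verts G. radj G u v \<longleftrightarrow> (\<forall>i<d. l u i \<le> r v i \<and> l v i \<le> r u i)"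
    unfolding irep_def by blast
  have le: "\<forall>i<d. l v i \<le> r v i" if "v \<in> verts G" for v using lr that by blast
  have "box_representation G d (\<lambda>v. \<Pi>\<^sub>E i\<in>{..<d}. {l v i..r v i})"
    unfolding box_representation_def
  proof (intro conjI ballI impI)
    fix v assume "v \<in> verts G"
    then show "is_box d (\<Pi>\<^sub>E i\<in>{..<d}. {l v i..r v i})" unfolding is_box_def using le by blast
  next
    fix u v assume "u \<in> verts G" "v \<in> verts G" "u \<noteq> v"
    then show "u \<rightarrow>\<^bsub>G\<^esub> v \<longleftrightarrow>
        (\<Pi>\<^sub>E i\<in>{..<d}. {l u i..r u i}) \<inter> (\<Pi>\<^sub>E i\<in>{..<d}. {l v i..r v i}) \<noteq> {}"
      using lr[rule_format, of u v] PiE_intervals_meet[OF le le, of u v] by simp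
  qed
  then show "\<exists>B. box_representation G d B" by blast
qed

text \<open>\<open>boxicity\<close> is a \<open>LEAST\<close>, so some representation must exist
  before its value is meaningful; the assumption provides one.\<close>

lemma boxicity_le_iff:
  assumes "irep (verts G) (radj G) k"
  shows "boxicity G \<le> d \<longleftrightarrow> irep (verts G) (radj G) d"
proof
  have "irep (verts G) (radj G) (boxicity G)"
    unfolding boxicity_def box_representation_iff_irep using assms by (rule LeastI)
  then show "boxicity G \<le> d \<Longrightarrow> irep (verts G) (radj G) d" using irep_mono by blast
next
  show "irep (verts G) (radj G) d \<Longrightarrow> boxicity G \<le> d"
    unfolding boxicity_def box_representation_iff_irep by (rule Least_le)
qed

lemma cluster_graph_no_induced_path:
  assumes "cluster_graph G" "u \<rightarrow>\<^bsub>G\<^esub> v" "v \<rightarrow>\<^bsub>G\<^esub> w" "u \<noteq> w"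
  shows "u \<rightarrow>\<^bsub>G\<^esub> w"
proof -
  obtain P where P: "partition_on (verts G) P"
    "arcs_ends G = (\<Union>C\<in>P. {(u, v). u \<in> C \<and> v \<in> C \<and> u \<noteq> v})"
    using assms(1) unfolding cluster_graph_def by blast
  then obtain C C' where "C \<in> P" "u \<in> C" "v \<in> C" "C' \<in> P" "v \<in> C'" "w \<in> C'"
    using assms(2,3) by auto
  moreover from this have "C = C'"
    using partition_onD2[OF P(1)] by (auto simp: disjoint_def)
  ultimately show ?thesis using P(2) assms(4) by auto
qed

lemma cluster_vertex_deletion_set:
  assumes "pair_graph G"
  obtains X where "X \<subseteq> pverts G" "card X = cluster_vertex_deletion_number (with_proj G)"
    "\<And>u v w. \<lbrakk>(u, v) \<in> parcs G; (v, w) \<in> parcs G; (u, w) \<notin> parcs G; u \<noteq> w\<rbrakk> \<Longrightarrow> u \<in> X \<or> v \<in> X \<or> w \<in> X"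
proof -
  interpret pair_graph G by (rule assms)
  let ?P = "\<lambda>k. \<exists>S\<subseteq>verts G. card S = k \<and> cluster_graph (with_proj G \<restriction> (verts G - S))"
  \<comment> \<open>Deleting all vertices leaves the empty cluster graph, so the minimum is
    attained.\<close>
  have "cluster_graph (with_proj G \<restriction> {})"
    unfolding cluster_graph_def
  proof
    show "graph (with_proj G \<restriction> {})"
      by unfold_locales
        (auto simp: induce_subgraph_def arcs_ends_def symmetric_def sym_def)
    show "\<exists>P. partition_on (verts (with_proj G \<restriction> {})) P \<and>
        arcs_ends (with_proj G \<restriction> {}) = (\<Union>C\<in>P. {(u, v). u \<in> C \<and> v \<in> C \<and> u \<noteq> v})"
      by (rule exI[of _ "{}"])
        (auto simp: partition_on_def induce_subgraph_def arcs_ends_def)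
  qed
  then have "?P (card (verts G))" by auto
  then have "?P (cluster_vertex_deletion_number (with_proj G))"
    unfolding cluster_vertex_deletion_number_def by (rule LeastI)
  then obtain X where X: "X \<subseteq> verts G" "card X = cluster_vertex_deletion_number (with_proj G)"
    and cl: "cluster_graph (with_proj G \<restriction> (verts G - X))" by blast
  have ends: "a \<rightarrow>\<^bsub>with_proj G \<restriction> (verts G - X)\<^esub> b \<longleftrightarrow> (a, b) \<in> parcs G \<and> a \<notin> X \<and> b \<notin> X" for a b
    by (auto simp: induce_subgraph_def arcs_ends_def arc_to_ends_def in_arcsD1 in_arcsD2
        dest: in_arcsD1 in_arcsD2)
  show thesis
  proof (rule that[of X])
    fix u v w assume "(u, v) \<in> parcs G" "(v, w) \<in> parcs G" "(u, w) \<notin> parcs G" "u \<noteq> w"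
    then show "u \<in> X \<or> v \<in> X \<or> w \<in> X"
      using cluster_graph_no_induced_path[OF cl, of u v w] unfolding ends by blast
  qed (use X in simp_all)
qed

section \<open>A modulator from greedily chosen induced paths\<close>

lemma rec_nat_invariant:
  assumes "I s" "\<And>i t. i < n \<Longrightarrow> I t \<Longrightarrow> I (f i t)"
  shows "I (rec_nat s f n)"
  using assms by (induction n) auto

lemma rec_nat_increasing:
  fixes \<mu> :: "'a \<Rightarrow> 'b set"
  assumes "\<And>i t. \<mu> t \<subseteq> \<mu> (f i t)"
  shows "\<mu> s \<subseteq> \<mu> (rec_nat s f n)"
  using assms by (induction n) auto

text \<open>Pass \<open>i\<close> establishes \<open>Q i\<close>, and later passes only enlarge the
  set.\<close>

lemma rec_nat_covers:
  fixes \<mu> :: "'a \<Rightarrow> 'b set"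
  assumes inc: "\<And>i t. \<mu> t \<subseteq> \<mu> (f i t)"
    and Q: "\<And>i t. i < n \<Longrightarrow> Q i (\<mu> (f i t))"
    and up: "\<And>i X Y. Q i X \<Longrightarrow> X \<subseteq> Y \<Longrightarrow> Q i Y" and i: "i < n"
  shows "Q i (\<mu> (rec_nat s f n))"
  using Q i
proof (induction n)
  case (Suc n)
  show ?case
  proof (cases "i = n")
    case True
    then show ?thesis using Suc.prems by simp
  next
    case False
    then have "Q i (\<mu> (rec_nat s f n))" using Suc by simp
    then show ?thesis using up inc by simp
  qed
qed simp

text \<open>No carry arises, so addition inserts an element into a bit mask; the machine has no
  bitwise instructions.\<close>

lemma bit_add_disjoint_power:
  fixes s :: nat
  assumes "\<not> bit s u"
  shows "bit (s + 2 ^ u) i \<longleftrightarrow> bit s i \<or> i = u"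
proof -
  have "s + 2 ^ u = or s (2 ^ u)"
    by (rule disjunctive_add) (use assms in \<open>auto simp: bit_exp_iff\<close>)
  then show ?thesis by (auto simp: bit_or_iff bit_exp_iff)
qed

definition greedy_step :: "(nat \<Rightarrow> nat \<Rightarrow> nat \<Rightarrow> bool) \<Rightarrow> nat \<Rightarrow> nat \<Rightarrow> nat \<Rightarrow> nat \<Rightarrow> nat" where
  "greedy_step P u v w s =
     (if P u v w \<and> \<not> bit s u \<and> \<not> bit s v \<and> \<not> bit s w then s + 2 ^ u + 2 ^ v + 2 ^ w else s)"

text \<open>Nested \<open>rec_nat\<close> is the semantics of nested \<open>Loop\<close>, so the
  program agrees with this function by unfolding.\<close>

definition greedy :: "(nat \<Rightarrow> nat \<Rightarrow> nat \<Rightarrow> bool) \<Rightarrow> nat \<Rightarrow> nat" where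
  "greedy P n = rec_nat 0 (\<lambda>u s. rec_nat s (\<lambda>v s. rec_nat s (\<lambda>w s. greedy_step P u v w s) n) n) n"

abbreviation bitset :: "nat \<Rightarrow> nat set" where "bitset s \<equiv> {i. bit s i}"

context
  fixes P :: "nat \<Rightarrow> nat \<Rightarrow> nat \<Rightarrow> bool" and n :: nat
  assumes distinct: "P u v w \<Longrightarrow> u \<noteq> v \<and> v \<noteq> w \<and> u \<noteq> w"
begin

lemma bitset_greedy_step:
  "bitset (greedy_step P u v w s) =
     (if P u v w \<and> \<not> bit s u \<and> \<not> bit s v \<and> \<not> bit s w then bitset s \<union> {u, v, w} else bitset s)"
  using distinct[of u v w] by (auto simp: greedy_step_def bit_add_disjoint_power)

text \<open>When the triple is visited, either one of its vertices is already in the mask or all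
  three enter; masks only grow.\<close>

lemma greedy_maximal:
  assumes "P u v w" "u < n" "v < n" "w < n"
  shows "bit (greedy P n) u \<or> bit (greedy P n) v \<or> bit (greedy P n) w"
proof -
  have inc1: "bitset s \<subseteq> bitset (greedy_step P u v w s)" for u v w s
    by (auto simp: bitset_greedy_step)
  have inc2: "bitset s \<subseteq> bitset (rec_nat s (\<lambda>w s. greedy_step P u v w s) n)" for u v s
    by (rule rec_nat_increasing) (rule inc1)
  have inc3: "bitset s \<subseteq> bitset (rec_nat s (\<lambda>v s. rec_nat s (\<lambda>w s. greedy_step P u v w s) n) n)" for u s
    by (rule rec_nat_increasing) (rule inc2)
  define Q where "Q u v w X \<longleftrightarrow> (P u v w \<longrightarrow> u \<in> X \<or> v \<in> X \<or> w \<in> X)" for u v w and X :: "nat set"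
  have up: "Q u v w X \<Longrightarrow> X \<subseteq> Y \<Longrightarrow> Q u v w Y" for u v w X Y by (auto simp: Q_def)
  have Q1: "Q u v w (bitset (greedy_step P u v w s))" for u v w s
    unfolding Q_def bitset_greedy_step by auto
  have Q2: "Q u v w (bitset (rec_nat s (\<lambda>w s. greedy_step P u v w s) n))" if "w < n" for u v w s
    by (rule rec_nat_covers[where Q = "Q u v"]) (use inc1 Q1 up that in auto)
  have Q3: "\<forall>w<n. Q u v w (bitset (rec_nat s (\<lambda>v s. rec_nat s (\<lambda>w s. greedy_step P u v w s) n) n))"
    if "v < n" for u v s
  proof (rule rec_nat_covers[where Q = "\<lambda>v X. \<forall>w<n. Q u v w X"])
    show "\<forall>w<n. Q u v w Y" if "\<forall>w<n. Q u v w X" "X \<subseteq> Y" for v X Y using that up by blast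
  qed (use inc2 Q2 that in simp_all)
  have "\<forall>v<n. \<forall>w<n. Q u v w (bitset (greedy P n))"
    unfolding greedy_def
  proof (rule rec_nat_covers[where Q = "\<lambda>u X. \<forall>v<n. \<forall>w<n. Q u v w X"])
    show "\<forall>v<n. \<forall>w<n. Q u v w Y" if "\<forall>v<n. \<forall>w<n. Q u v w X" "X \<subseteq> Y" for u X Y
      using that up by blast
  qed (use inc3 Q3 assms in simp_all)
  then show ?thesis using assms by (auto simp: Q_def)
qed

text \<open>The chosen triples are disjoint and each contains a vertex of \<open>X\<close>. As an
  invariant: the mask has at most three times as many elements as it shares with
  \<open>X\<close>.\<close>

lemma greedy_small:
  assumes "finite X" and hit: "\<And>u v w. P u v w \<Longrightarrow> u \<in> X \<or> v \<in> X \<or> w \<in> X"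
  shows "bitset (greedy P n) \<subseteq> {..<n}" "card (bitset (greedy P n)) \<le> 3 * card X"
proof -
  define I where "I s \<longleftrightarrow> bitset s \<subseteq> {..<n} \<and> card (bitset s) \<le> 3 * card (bitset s \<inter> X)" for s
  have step: "I (greedy_step P u v w s)" if I: "I s" and lt: "u < n" "v < n" "w < n" for u v w s
  proof (cases "P u v w \<and> \<not> bit s u \<and> \<not> bit s v \<and> \<not> bit s w")
    case True
    then have b: "bitset (greedy_step P u v w s) = bitset s \<union> {u, v, w}"
      unfolding bitset_greedy_step by simp
    have fin: "finite (bitset s)" using I finite_subset by (auto simp: I_def)
    have "card (bitset s \<union> {u, v, w}) \<le> card (bitset s) + 3"
      using card_Un_le[of "bitset s" "{u, v, w}"] card_length[of "[u, v, w]"] by simp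
    moreover have "card (bitset s \<inter> X) + 1 \<le> card ((bitset s \<union> {u, v, w}) \<inter> X)"
    proof -
      have "bitset s \<inter> X \<subset> (bitset s \<union> {u, v, w}) \<inter> X"
        using hit[of u v w] True by auto
      then have "card (bitset s \<inter> X) < card ((bitset s \<union> {u, v, w}) \<inter> X)"
        using fin by (intro psubset_card_mono) auto
      then show ?thesis by linarith
    qed
    ultimately show ?thesis using I lt unfolding I_def b by auto
  next
    case False
    then have "greedy_step P u v w s = s" unfolding greedy_step_def by meson
    then show ?thesis using I by simp
  qed
  have step2: "I (rec_nat s (\<lambda>w s. greedy_step P u v w s) n)" if "I s" "u < n" "v < n" for u v s
    by (rule rec_nat_invariant[where I = I]) (use step that in simp_all)
  have step3: "I (rec_nat s (\<lambda>v s. rec_nat s (\<lambda>w s. greedy_step P u v w s) n) n)"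
    if "I s" "u < n" for u s
    by (rule rec_nat_invariant[where I = I]) (use step2 that in simp_all)
  have "I (greedy P n)"
    unfolding greedy_def by (rule rec_nat_invariant[where I = I]) (use step3 in \<open>simp_all add: I_def\<close>)
  then have *: "bitset (greedy P n) \<subseteq> {..<n}"
    "card (bitset (greedy P n)) \<le> 3 * card (bitset (greedy P n) \<inter> X)" by (auto simp: I_def)
  have "card (bitset (greedy P n) \<inter> X) \<le> card X" using assms(1) by (intro card_mono) auto
  then show "card (bitset (greedy P n)) \<le> 3 * card X" using *(2) by linarith
  show "bitset (greedy P n) \<subseteq> {..<n}" by (rule *(1))
qed

end

section \<open>Boolean expressions\<close>

definition holds :: "nat list \<Rightarrow> expr \<Rightarrow> nat list \<Rightarrow> bool" where
  "holds xs e env \<longleftrightarrow> eval xs e env \<noteq> 0"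

definition "And a b = Cond a b (Num 0)"
definition "Or a b = Cond a (Num 1) b"
definition "Imp a b = Cond a b (Num 1)"
definition "Neg a = Cond a (Num 0) (Num 1)"
definition "Iff a b = Cond a b (Neg b)"
definition "Lt a b = Cond (Minus b a) (Num 1) (Num 0)"
definition "Eql a b = Cond (Plus (Minus a b) (Minus b a)) (Num 0) (Num 1)"
text \<open>\<open>Init\<close> hides the accumulator from \<open>b\<close>, which thus sees only
  the counter; \<open>Last 1 (Var 0)\<close> reads the accumulator. A witness does not end the
  loop.\<close>

definition "Exists e b = Loop e (Num 0) (Cond (Init b) (Num 1) (Last 1 (Var 0)))"
definition "Forall e b = Neg (Exists e (Neg b))"
definition "Cnt e b = Loop e (Num 0) (Plus (Last 1 (Var 0)) (Cond (Init b) (Num 1) (Num 0)))"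

text \<open>The arguments are evaluated in an environment extended by the earlier arguments, which is
  harmless because variables are numbered from the bottom of the environment.\<close>

definition "Call f es = foldr Bind es (Last (length es) f)"

lemma eval_Exists: "eval xs (Exists e b) env = of_bool (\<exists>i<eval xs e env. holds xs b (env @ [i]))"
proof -
  have "rec_nat 0 (\<lambda>i r. if P i then r else 1) m = (of_bool (\<exists>i<m. \<not> P i) :: nat)" for P m
    by (induction m) (auto simp: less_Suc_eq)
  then show ?thesis by (simp add: Exists_def holds_def butlast_append cong: if_cong)
qed

lemma eval_Cnt: "eval xs (Cnt e b) env = card {i. i < eval xs e env \<and> holds xs b (env @ [i])}"
proof -
  have "rec_nat 0 (\<lambda>i r. r + (if P i then 0 else 1)) m = card {i. i < m \<and> \<not> P i}" for P and m :: nat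
  proof (induction m)
    case (Suc m)
    have "{i. i < Suc m \<and> \<not> P i} = (if P m then {i. i < m \<and> \<not> P i} else insert m {i. i < m \<and> \<not> P i})"
      by (auto simp: less_Suc_eq)
    then show ?case using Suc by simp
  qed simp
  then show ?thesis by (simp add: Cnt_def holds_def butlast_append cong: if_cong)
qed

lemma holds_simps [simp]:
  "holds xs (And a b) env \<longleftrightarrow> holds xs a env \<and> holds xs b env"
  "holds xs (Or a b) env \<longleftrightarrow> holds xs a env \<or> holds xs b env"
  "holds xs (Imp a b) env \<longleftrightarrow> (holds xs a env \<longrightarrow> holds xs b env)"
  "holds xs (Neg a) env \<longleftrightarrow> \<not> holds xs a env"
  "holds xs (Iff a b) env \<longleftrightarrow> (holds xs a env \<longleftrightarrow> holds xs b env)"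
  "holds xs (Lt a b) env \<longleftrightarrow> eval xs a env < eval xs b env"
  "holds xs (Eql a b) env \<longleftrightarrow> eval xs a env = eval xs b env"
  "holds xs (Exists e b) env \<longleftrightarrow> (\<exists>i<eval xs e env. holds xs b (env @ [i]))"
  "holds xs (Forall e b) env \<longleftrightarrow> (\<forall>i<eval xs e env. holds xs b (env @ [i]))"
  by (auto simp: holds_def And_def Or_def Imp_def Neg_def Iff_def Lt_def Eql_def Forall_def eval_Exists)

text \<open>Short-circuit evaluation is kept visible because comparisons of a vertex with
  \<open>n_expr\<close> guard loops that are short only under that guard.\<close>

lemma bnd_simps [simp]:
  "bnd W xs (And a b) env \<longleftrightarrow> bnd W xs a env \<and> (holds xs a env \<longrightarrow> bnd W xs b env)"
  "bnd W xs (Or a b) env \<longleftrightarrow> bnd W xs a env \<and> (\<not> holds xs a env \<longrightarrow> bnd W xs b env)"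
  "bnd W xs (Imp a b) env \<longleftrightarrow> bnd W xs a env \<and> (holds xs a env \<longrightarrow> bnd W xs b env)"
  "bnd W xs (Neg a) env \<longleftrightarrow> bnd W xs a env"
  "bnd W xs (Iff a b) env \<longleftrightarrow> bnd W xs a env \<and> bnd W xs b env"
  "bnd W xs (Lt a b) env \<longleftrightarrow> bnd W xs a env \<and> bnd W xs b env"
  "bnd W xs (Eql a b) env \<longleftrightarrow> bnd W xs a env \<and> bnd W xs b env"
  "bnd W xs (Exists e b) env \<longleftrightarrow> bnd W xs e env \<and> eval xs e env \<le> W \<and>
     (\<forall>i<eval xs e env. bnd W xs b (env @ [i]))"
  "bnd W xs (Forall e b) env \<longleftrightarrow> bnd W xs e env \<and> eval xs e env \<le> W \<and>
     (\<forall>i<eval xs e env. bnd W xs b (env @ [i]))"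
  "bnd W xs (Cnt e b) env \<longleftrightarrow> bnd W xs e env \<and> eval xs e env \<le> W \<and>
     (\<forall>i<eval xs e env. bnd W xs b (env @ [i]))"
  by (auto simp: holds_def And_def Or_def Imp_def Neg_def Iff_def Lt_def Eql_def Exists_def
      Forall_def Cnt_def butlast_append)

lemma eval_Cond [simp]:
  "eval xs (Cond a b c) env = (if holds xs a env then eval xs b env else eval xs c env)"
  by (simp add: holds_def)

lemma bnd_Cond [simp]:
  "bnd W xs (Cond a b c) env \<longleftrightarrow>
     bnd W xs a env \<and> (if holds xs a env then bnd W xs b env else bnd W xs c env)"
  by (simp add: holds_def)

declare eval.simps(7) [simp del] bnd.simps(7) [simp del]

lemma holds_Bind [simp]: "holds xs (Bind a b) env \<longleftrightarrow> holds xs b (env @ [eval xs a env])"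
  by (simp add: holds_def)

lemma holds_Last [simp]: "holds xs (Last k a) env \<longleftrightarrow> holds xs a (drop (length env - k) env)"
  by (simp add: holds_def)

declare Call_def [simp]

section \<open>Arithmetic\<close>

text \<open>The loop runs over the first factor, so only that one counts for
  \<open>bnd\<close>.\<close>

definition "mul_expr = Loop (Var 0) (Num 0) (Plus (Var 3) (Var 1))"
definition "pow2_expr = Loop (Var 0) (Num 1) (Plus (Var 2) (Var 2))"
definition "shift_expr = Loop (Var 1) (Var 0) (Hlf (Var 3))"
definition "bit_expr = Bind (Call shift_expr [Var 0, Var 1]) (Minus (Var 2) (Plus (Hlf (Var 2)) (Hlf (Var 2))))"

lemma eval_mul [simp]: "eval xs mul_expr [a, b] = a * b"
proof -
  have "rec_nat 0 (\<lambda>i r. r + b) a = a * b" by (induction a) auto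
  then show ?thesis by (simp add: mul_expr_def)
qed

lemma bnd_mul [simp]: "bnd W xs mul_expr [a, b] \<longleftrightarrow> a \<le> W"
  by (simp add: mul_expr_def)

lemma eval_pow2 [simp]: "eval xs pow2_expr [a] = 2 ^ a"
proof -
  have "rec_nat 1 (\<lambda>i r. r + r) a = (2 ^ a :: nat)" by (induction a) auto
  then show ?thesis by (simp add: pow2_expr_def)
qed

lemma bnd_pow2 [simp]: "bnd W xs pow2_expr [a] \<longleftrightarrow> a \<le> W"
  by (simp add: pow2_expr_def)

lemma eval_shift [simp]: "eval xs shift_expr [x, i] = x div 2 ^ i"
proof -
  have "rec_nat x (\<lambda>i r. r div 2) i = x div 2 ^ i"
    by (induction i) (auto simp: div_mult2_eq[symmetric] mult.commute)
  then show ?thesis by (simp add: shift_expr_def)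
qed

lemma bnd_shift [simp]: "bnd W xs shift_expr [x, i] \<longleftrightarrow> i \<le> W"
  by (simp add: shift_expr_def)

lemma holds_bit [simp]: "holds xs bit_expr [x, i] \<longleftrightarrow> bit x i"
proof -
  have "y \<le> y div 2 + y div 2 \<longleftrightarrow> even y" for y :: nat by presburger
  then show ?thesis by (simp add: bit_expr_def holds_def bit_iff_odd)
qed

lemma bnd_bit [simp]: "bnd W xs bit_expr [x, i] \<longleftrightarrow> i \<le> W"
  by (simp add: bit_expr_def)

definition "digit z b p = z div 2 ^ (b * p) mod 2 ^ b" for z b p :: nat

text \<open>A remainder without division: shift by \<open>b\<close>, double \<open>b\<close> times,
  subtract.\<close>

definition "digit_expr = Bind (Call shift_expr [Var 0, Call mul_expr [Var 1, Var 2]])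
   (Minus (Var 3) (Loop (Var 1) (Call shift_expr [Var 3, Var 1]) (Plus (Var 5) (Var 5))))"

lemma eval_digit [simp]: "eval xs digit_expr [z, b, p] = digit z b p"
proof -
  have "rec_nat x (\<lambda>i r. r + r) m = x * 2 ^ m" for x m :: nat by (induction m) auto
  then show ?thesis
    by (simp add: digit_expr_def digit_def minus_div_mult_eq_mod)
qed

lemma bnd_digit [simp]: "bnd W xs digit_expr [z, b, p] \<longleftrightarrow> b \<le> W \<and> b * p \<le> W"
  by (auto simp: digit_expr_def)

text \<open>One counter below \<open>2 ^ (b * L)\<close> thus runs through all sequences of
  \<open>L\<close> digits, so guessing a representation becomes a single loop.\<close>

lemma digits_exist:
  fixes g :: "nat \<Rightarrow> nat"
  assumes "\<And>p. p < L \<Longrightarrow> g p < 2 ^ b"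
  shows "\<exists>z<2 ^ (b * L). \<forall>p<L. digit z b p = g p"
  using assms
proof (induction L)
  case (Suc L)
  then obtain z where z: "z < 2 ^ (b * L)" "\<forall>p<L. digit z b p = g p" by auto
  define y where "y = z + g L * 2 ^ (b * L)"
  have "y < (g L + 1) * 2 ^ (b * L)" using z(1) by (simp add: y_def)
  also have "\<dots> \<le> 2 ^ b * 2 ^ (b * L)" using Suc.prems[of L] by (intro mult_le_mono1) simp
  finally have y: "y < 2 ^ (b * Suc L)" by (simp add: power_add)
  have "digit y b p = g p" if "p < Suc L" for p
  proof (cases "p = L")
    case True
    then show ?thesis using z(1) Suc.prems[of L] by (simp add: digit_def y_def)
  next
    case False
    then have p: "p < L" using that by simp
    \<comment> \<open>After the shift to digit \<open>p\<close>, the new leading digit contributes a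
      multiple of \<open>2 ^ b\<close>.\<close>
    have "b * L = b * p + b + b * (L - Suc p)"
    proof -
      have "L = p + 1 + (L - Suc p)" using p by simp
      then have "b * L = b * (p + 1 + (L - Suc p))" by simp
      then show ?thesis by (simp only: distrib_left mult_1_right)
    qed
    then have "(2::nat) ^ (b * L) = 2 ^ (b * p) * 2 ^ b * 2 ^ (b * (L - Suc p))"
      by (metis power_add)
    then have "y = z + (g L * 2 ^ (b * (L - Suc p)) * 2 ^ b) * 2 ^ (b * p)"
      by (simp only: y_def mult_ac)
    then have "y div 2 ^ (b * p) = z div 2 ^ (b * p) + g L * 2 ^ (b * (L - Suc p)) * 2 ^ b" by simp
    then have "digit y b p = digit z b p" by (simp add: digit_def)
    then show ?thesis using z(2) p by simp
  qed
  then show ?case using y by blast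
qed simp

section \<open>The algorithm\<close>

definition "n_expr = Inp (Num 0)"

text \<open>The matrix follows three header entries. The guards bound the loop of the product and
  keep a column index beyond the end of a row from reading the next row.\<close>

definition "adj_expr = Or (Eql (Var 0) (Var 1)) (And (And (Lt (Var 0) n_expr) (Lt (Var 1) n_expr))
   (Inp (Plus (Num 3) (Plus (Call mul_expr [Var 0, n_expr]) (Var 1)))))"

text \<open>The environment is \<open>[u, _, v, _, w, s]\<close>, where \<open>s\<close> is the bit mask of the vertices chosen so far
  and the gaps are the accumulators of the outer loops.\<close>

definition "greedy_body = Cond
   (And (And (Call adj_expr [Var 0, Var 2]) (And (Call adj_expr [Var 2, Var 4]) (Neg (Call adj_expr [Var 0, Var 4]))))
     (And (Neg (Call bit_expr [Var 5, Var 0])) (And (Neg (Call bit_expr [Var 5, Var 2]))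
       (Neg (Call bit_expr [Var 5, Var 4])))))
   (Plus (Plus (Plus (Var 5) (Call pow2_expr [Var 0])) (Call pow2_expr [Var 2])) (Call pow2_expr [Var 4]))
   (Var 5)"

definition "greedy_expr = Loop n_expr (Num 0) (Loop n_expr (Last 1 (Var 0)) (Loop n_expr (Last 1 (Var 0)) greedy_body))"

definition "mem_expr = And (Lt (Var 1) n_expr) (Call bit_expr [Var 0, Var 1])"
definition "rest_expr = And (Lt (Var 1) n_expr) (Neg (Call bit_expr [Var 0, Var 1]))"

definition "same_expr = Forall n_expr (Imp (Call mem_expr [Var 0, Var 3])
   (Iff (Call adj_expr [Var 1, Var 3]) (Call adj_expr [Var 2, Var 3])))"

text \<open>Families of subsets of \<open>S\<close> are compared through the vertices that realise
  them, so no family is ever stored.\<close>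

definition "types_le_expr = Forall n_expr
   (Imp (And (Call rest_expr [Var 0, Var 3]) (Call adj_expr [Var 3, Var 1]))
     (Exists n_expr (And (Call rest_expr [Var 0, Var 4])
       (And (Call adj_expr [Var 4, Var 2]) (Call same_expr [Var 0, Var 3, Var 4])))))"

definition "leader_expr = And (Call rest_expr [Var 0, Var 1])
   (Neg (Exists (Var 1) (And (Call rest_expr [Var 0, Var 2]) (Call adj_expr [Var 2, Var 1]))))"

definition "twin_free_expr = Neg (Exists (Var 1) (And (Call rest_expr [Var 0, Var 2])
   (And (Call adj_expr [Var 2, Var 1]) (Call same_expr [Var 0, Var 2, Var 1]))))"

definition "earlier_expr = Cnt (Var 1) (And (Call leader_expr [Var 0, Var 2])
   (And (Call types_le_expr [Var 0, Var 1, Var 2]) (Call types_le_expr [Var 0, Var 2, Var 1])))"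

definition "kept_expr = And (Lt (Var 2) n_expr) (Or (Call mem_expr [Var 0, Var 2])
   (And (Call twin_free_expr [Var 0, Var 2])
     (Exists n_expr (And (Call leader_expr [Var 0, Var 3]) (And (Call adj_expr [Var 3, Var 2])
       (Neg (Lt (Var 1) (Call earlier_expr [Var 0, Var 3]))))))))"

text \<open>Digits are indexed by rank among the kept vertices; with the vertices themselves as
  indices the length of a candidate would depend on \<open>n\<close>.\<close>

definition "rank_expr = Cnt (Var 2) (Call kept_expr [Var 0, Var 1, Var 3])"

text \<open>In a candidate \<open>z\<close> with \<open>b\<close>-bit digits and \<open>m\<close> dimensions, digits \<open>2 (p m + i)\<close> and
  \<open>2 (p m + i) + 1\<close> are the endpoints in dimension \<open>i\<close> of the \<open>p\<close>-th kept vertex. The environment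
  is \<open>[z, b, m, p, q, i]\<close>.\<close>

definition "below_expr = Neg (Lt
   (Call digit_expr [Var 0, Var 1, Plus (Plus (Call mul_expr [Var 4, Var 2]) (Var 5)) (Plus (Call mul_expr [Var 4, Var 2]) (Plus (Var 5) (Num 1)))])
   (Call digit_expr [Var 0, Var 1, Plus (Plus (Call mul_expr [Var 3, Var 2]) (Var 5)) (Plus (Call mul_expr [Var 3, Var 2]) (Var 5))]))"

definition "meet_expr = Forall (Var 2) (And (Call below_expr [Var 0, Var 1, Var 2, Var 3, Var 4, Var 5])
   (Call below_expr [Var 0, Var 1, Var 2, Var 4, Var 3, Var 5]))"

text \<open>Environment \<open>[s, N, m, b, z]\<close>.\<close>

definition "check_expr = Forall n_expr (Imp (Call kept_expr [Var 0, Var 1, Var 5])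
   (Forall n_expr (Imp (Call kept_expr [Var 0, Var 1, Var 6])
     (Iff (Call adj_expr [Var 5, Var 6])
       (Call meet_expr [Var 4, Var 3, Var 2, Call rank_expr [Var 0, Var 1, Var 5],
          Call rank_expr [Var 0, Var 1, Var 6]])))))"

text \<open>Environment \<open>[s, N, m, h, b]\<close>.\<close>

definition "search_expr = Exists (Call pow2_expr [Call mul_expr [Var 4, Plus (Call mul_expr [Var 3, Var 2]) (Call mul_expr [Var 3, Var 2])]])
   (Call check_expr [Var 0, Var 1, Var 2, Var 4, Var 5])"

definition "exponent_expr =
   Call mul_expr [Plus (Plus (Call pow2_expr [Var 0]) (Call pow2_expr [Var 0])) (Plus (Plus (Var 0) (Var 0)) (Plus (Var 0) (Var 0))), Var 1]"

definition "sign_expr = Inp (Num 1)"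

text \<open>The cap makes the number of axes searched, and with it every loop length, bounded
  independently of \<open>d\<close>.\<close>

definition "dim_expr = Cond (Lt (Inp (Num 2)) (Plus (Var 0) (Num 1))) (Inp (Num 2)) (Plus (Var 0) (Num 1))"

text \<open>The bindings are the modulator \<open>s\<close>, its size, the capped dimension, the
  threshold \<open>N\<close>, the number of kept vertices and the digit width \<open>b\<close>.
  \<open>N\<close> is only compared with, never looped over. Endpoints can be chosen below
  \<open>b\<close>, so \<open>b\<close> bits suffice and no logarithm is computed.\<close>

definition "main_expr = Cond sign_expr (Num 0)
   (Bind greedy_expr
   (Bind (Cnt n_expr (Call mem_expr [Var 0, Var 1]))
   (Bind (Call dim_expr [Var 1])
   (Bind (Call pow2_expr [Call exponent_expr [Var 1, Var 2]])
   (Bind (Call rank_expr [Var 0, Var 3, n_expr])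
   (Bind (Plus (Var 4) (Var 4))
   (Call search_expr [Var 0, Var 3, Var 2, Var 4, Var 5])))))))"

section \<open>Values and loop bounds of the programs on an instance\<close>

lemma concat_matrix_length: "length (concat (map (\<lambda>u. map (f u) [0..<n]) [0..<m])) = m * n"
  by (induction m) auto

lemma concat_matrix_nth:
  assumes "u < m" "v < n"
  shows "concat (map (\<lambda>u. map (f u) [0..<n]) [0..<m]) ! (u * n + v) = f u v"
  using assms
proof (induction m)
  case (Suc m)
  show ?case
  proof (cases "u = m")
    case True
    then show ?thesis using Suc.prems by (simp add: nth_append concat_matrix_length)
  next
    case False
    then have "u < m" using Suc.prems by simp
    then have "Suc u * n \<le> m * n" by (intro mult_le_mono1) simp
    then have "u * n + v < m * n" using Suc.prems by simp
    then show ?thesis using Suc \<open>u < m\<close> by (simp add: nth_append concat_matrix_length)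
  qed
qed simp

locale boxicity_input =
  fixes G :: "nat pair_pre_digraph" and n :: nat and d :: int and xs :: "nat list"
  assumes graph: "pair_graph G" and verts: "pverts G = {0..<n}"
    and xs: "xs = boxicity_instance G d"
begin

definition E where "E u v \<longleftrightarrow> u = v \<or> (u, v) \<in> parcs G"

lemma parcs_less: "(u, v) \<in> parcs G \<Longrightarrow> u < n \<and> v < n \<and> u \<noteq> v"
proof -
  interpret pair_graph G by (rule graph)
  show "(u, v) \<in> parcs G \<Longrightarrow> u < n \<and> v < n \<and> u \<noteq> v"
    using in_arcsD1 in_arcsD2 no_loops verts by fastforce
qed

lemma E_sym: "E u v \<longleftrightarrow> E v u"
proof -
  interpret pair_graph G by (rule graph)
  show ?thesis unfolding E_def using arcs_symmetric by blast
qed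

lemma xs_nth:
  "xs ! 0 = n" "xs ! 1 = of_bool (d < 0)" "xs ! 2 = nat \<bar>d\<bar>" "length xs = 3 + n * n"
  by (simp_all add: xs boxicity_instance_def Let_def verts concat_matrix_length nth_Cons')

lemma xs_adj: "u < n \<Longrightarrow> v < n \<Longrightarrow> xs ! (3 + (u * n + v)) = of_bool ((u, v) \<in> parcs G)"
  unfolding xs boxicity_instance_def Let_def by (simp add: verts concat_matrix_nth)

lemma eval_n [simp]: "eval xs n_expr env = n"
  by (simp add: n_expr_def xs_nth Let_def)

lemma bnd_n [simp]: "bnd W xs n_expr env"
  by (simp add: n_expr_def)

lemma holds_sign [simp]: "holds xs sign_expr env \<longleftrightarrow> d < 0"
  using xs_nth(2,4) by (simp add: sign_expr_def holds_def Let_def)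

lemma bnd_sign [simp]: "bnd W xs sign_expr env"
  by (simp add: sign_expr_def)

definition "capped_dim k = min (nat \<bar>d\<bar>) (k + 1)"

lemma eval_dim [simp]: "eval xs dim_expr [k] = capped_dim k"
proof -
  have "eval xs (Inp (Num 2)) env = nat \<bar>d\<bar>" for env
    using xs_nth(3,4) by (simp add: Let_def)
  then show ?thesis by (simp add: dim_expr_def capped_dim_def min_def del: eval.simps(3))
qed

lemma bnd_dim [simp]: "bnd W xs dim_expr [k]"
  by (simp add: dim_expr_def)

lemma holds_adj [simp]: "holds xs adj_expr [u, v] \<longleftrightarrow> E u v"
proof (cases "u < n \<and> v < n")
  case True
  then have "Suc u * n \<le> n * n" by (intro mult_le_mono1) simp
  then have idx: "u * n + v < n * n" using True by simp
  have "holds xs (Inp (Plus (Num 3) (Plus (Call mul_expr [Var 0, n_expr]) (Var 1)))) [u, v] \<longleftrightarrow>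
      (u, v) \<in> parcs G"
    using True xs_adj[of u v] idx by (simp add: holds_def xs_nth)
  then show ?thesis using True by (simp add: adj_expr_def E_def del: Call_def)
next
  case False
  then show ?thesis using parcs_less by (auto simp: adj_expr_def E_def)
qed

lemma bnd_adj [simp]: "n \<le> W \<Longrightarrow> bnd W xs adj_expr [u, v]"
  by (simp add: adj_expr_def)

definition "path3 u v w \<longleftrightarrow> E u v \<and> E v w \<and> \<not> E u w"

lemma eval_greedy: "eval xs greedy_expr [] = greedy path3 n"
  unfolding greedy_def greedy_step_def path3_def
  by (simp add: greedy_expr_def greedy_body_def cong: if_cong)

lemma bnd_greedy: "n \<le> W \<Longrightarrow> bnd W xs greedy_expr []"
  by (simp add: greedy_expr_def greedy_body_def)

lemma holds_mem [simp]: "holds xs mem_expr [s, v] \<longleftrightarrow> v < n \<and> bit s v"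
  by (simp add: mem_expr_def)

lemma bnd_mem [simp]: "n \<le> W \<Longrightarrow> bnd W xs mem_expr [s, v]"
  by (simp add: mem_expr_def)

lemma holds_rest [simp]: "holds xs rest_expr [s, v] \<longleftrightarrow> v < n \<and> \<not> bit s v"
  by (simp add: rest_expr_def)

lemma bnd_rest [simp]: "n \<le> W \<Longrightarrow> bnd W xs rest_expr [s, v]"
  by (simp add: rest_expr_def)

lemma bnd_same [simp]: "n \<le> W \<Longrightarrow> bnd W xs same_expr [s, u, v]"
  by (simp add: same_expr_def)

lemma bnd_types_le [simp]: "n \<le> W \<Longrightarrow> bnd W xs types_le_expr [s, u, v]"
  by (simp add: types_le_expr_def)

lemma bnd_leader [simp]: "n \<le> W \<Longrightarrow> bnd W xs leader_expr [s, c]"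
  by (simp add: leader_expr_def)

lemma bnd_twin_free [simp]: "n \<le> W \<Longrightarrow> v < n \<Longrightarrow> bnd W xs twin_free_expr [s, v]"
  by (simp add: twin_free_expr_def)

lemma bnd_earlier [simp]: "n \<le> W \<Longrightarrow> c < n \<Longrightarrow> bnd W xs earlier_expr [s, c]"
  by (simp add: earlier_expr_def)

lemma bnd_kept [simp]: "n \<le> W \<Longrightarrow> bnd W xs kept_expr [s, N, v]"
  by (simp add: kept_expr_def)

lemma bnd_rank [simp]: "n \<le> W \<Longrightarrow> v \<le> n \<Longrightarrow> bnd W xs rank_expr [s, N, v]"
  by (simp add: rank_expr_def)

lemma holds_below [simp]: "holds xs below_expr [z, b, m, p, q, i] \<longleftrightarrow>
    digit z b (2 * (p * m + i)) \<le> digit z b (2 * (q * m + i) + 1)"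
  by (simp add: below_expr_def not_less flip: mult_2)

lemma holds_meet [simp]: "holds xs meet_expr [z, b, m, p, q] \<longleftrightarrow> (\<forall>i<m.
    digit z b (2 * (p * m + i)) \<le> digit z b (2 * (q * m + i) + 1) \<and>
    digit z b (2 * (q * m + i)) \<le> digit z b (2 * (p * m + i) + 1))"
  by (simp add: meet_expr_def)

lemma bnd_below:
  assumes "i < m" "p < h" "q < h" "h \<le> W" "b \<le> W" "b * (2 * (h * m)) \<le> W"
  shows "bnd W xs below_expr [z, b, m, p, q, i]"
proof -
  have pos: "b * (2 * (p * m + i) + 1) \<le> W" if "p < h" for p
  proof -
    have "Suc p * m \<le> h * m" using that by (intro mult_le_mono1) simp
    then have "2 * (p * m + i) + 1 \<le> 2 * (h * m)" using assms(1) by simp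
    then have "b * (2 * (p * m + i) + 1) \<le> b * (2 * (h * m))" by (rule mult_le_mono2)
    then show ?thesis using assms(6) by linarith
  qed
  have "b * (2 * (p * m + i)) \<le> W" using pos[OF assms(2)] by simp
  then show ?thesis using pos[OF assms(3)] assms by (simp add: below_expr_def flip: mult_2)
qed

lemma bnd_meet:
  assumes "p < h" "q < h" "h \<le> W" "b \<le> W" "b * (2 * (h * m)) \<le> W" "m \<le> W"
  shows "bnd W xs meet_expr [z, b, m, p, q]"
  using assms bnd_below[of _ m _ h _ W b] by (simp add: meet_expr_def)

end

section \<open>The kernel and the search for a fixed modulator\<close>

locale boxicity_modulator = boxicity_input +
  fixes s :: nat
  assumes mod: "cluster_modulator n E (bitset s)"
begin

sublocale M: cluster_modulator n E "bitset s" by (rule mod)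

lemma bit_less: "bit s v \<Longrightarrow> v < n" using M.S_sub by auto

lemma U_iff: "v \<in> M.U \<longleftrightarrow> v < n \<and> \<not> bit s v" by (auto simp: M.U_def)

lemma holds_same [simp]: "holds xs same_expr [s, u, v] \<longleftrightarrow> M.same_type u v"
  using bit_less by (auto simp: same_expr_def M.same_type_def)

lemma holds_types_le [simp]: "holds xs types_le_expr [s, u, v] \<longleftrightarrow> M.types u \<subseteq> M.types v"
proof -
  have "holds xs types_le_expr [s, u, v] \<longleftrightarrow>
      (\<forall>x\<in>M.U. E x u \<longrightarrow> (\<exists>y\<in>M.U. E y v \<and> M.nbh x = M.nbh y))"
    by (simp add: types_le_expr_def U_iff M.same_type_iff Ball_def Bex_def) blast
  then show ?thesis unfolding M.types_def by blast
qed

lemma holds_leader [simp]: "holds xs leader_expr [s, c] \<longleftrightarrow> M.leader c"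
  by (auto simp: leader_expr_def M.leader_def U_iff)

lemma holds_twin_free [simp]: "holds xs twin_free_expr [s, v] \<longleftrightarrow> M.twin_free v"
  by (auto simp: twin_free_expr_def M.twin_free_def U_iff)

lemma eval_earlier [simp]: "eval xs earlier_expr [s, c] = card (M.earlier c)"
proof -
  have "{i. i < c \<and> M.leader i \<and> M.types c \<subseteq> M.types i \<and> M.types i \<subseteq> M.types c} = M.earlier c"
    by (auto simp: M.earlier_def)
  then show ?thesis by (simp add: earlier_expr_def eval_Cnt)
qed

lemma holds_kept [simp]: "holds xs kept_expr [s, N, v] \<longleftrightarrow> M.kept N v"
proof -
  have "M.leader c \<Longrightarrow> c < n" for c by (simp add: M.leader_def U_iff)
  then show ?thesis by (auto simp: kept_expr_def M.kept_def not_less)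
qed

definition "rank N v = card {u. u < v \<and> M.kept N u}"

lemma eval_rank [simp]: "eval xs rank_expr [s, N, v] = rank N v"
  by (simp add: rank_expr_def eval_Cnt rank_def)

lemma kept_less: "M.kept N v \<Longrightarrow> v < n" by (simp add: M.kept_def)

lemma finite_kept: "finite {v. M.kept N v}"
  by (rule finite_subset[of _ "{..<n}"]) (auto dest: kept_less)

lemma card_kept_le: "card {v. M.kept N v} \<le> n"
proof -
  have "card {v. M.kept N v} \<le> card {..<n}" by (rule card_mono) (auto dest: kept_less)
  then show ?thesis by simp
qed

lemma rank_n: "rank N n = card {v. M.kept N v}"
  unfolding rank_def by (rule arg_cong[of _ _ card]) (auto dest: kept_less)

lemma bij_rank: "bij_betw (rank N) {v. M.kept N v} {..<card {v. M.kept N v}}"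
proof -
  have mono: "rank N u < rank N v" if "u < v" "M.kept N u" for u v
    unfolding rank_def by (rule psubset_card_mono) (use that in auto)
  have "inj_on (rank N) {v. M.kept N v}"
    by (rule inj_onI) (metis mem_Collect_eq mono linorder_neqE_nat less_irrefl)
  moreover have "rank N ` {v. M.kept N v} \<subseteq> {..<card {v. M.kept N v}}"
    using mono kept_less by (auto simp flip: rank_n)
  ultimately show ?thesis
    unfolding bij_betw_def by (metis card_image card_lessThan card_subset_eq finite_lessThan)
qed

lemma rank_less: "M.kept N v \<Longrightarrow> rank N v < card {v. M.kept N v}"
  using bij_betwE[OF bij_rank] by blast

definition "coded N m b z u v \<longleftrightarrow> (\<forall>i<m.
    digit z b (2 * (rank N u * m + i)) \<le> digit z b (2 * (rank N v * m + i) + 1) \<and>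
    digit z b (2 * (rank N v * m + i)) \<le> digit z b (2 * (rank N u * m + i) + 1))"

lemma holds_check [simp]: "holds xs check_expr [s, N, m, b, z] \<longleftrightarrow>
    (\<forall>u\<in>{v. M.kept N v}. \<forall>v\<in>{v. M.kept N v}. E u v \<longleftrightarrow> coded N m b z u v)"
  using kept_less by (auto simp: check_expr_def coded_def)

lemma bnd_check:
  assumes "n \<le> W" "h = card {v. M.kept N v}" "b \<le> W" "b * (2 * (h * m)) \<le> W" "m \<le> W"
  shows "bnd W xs check_expr [s, N, m, b, z]"
proof -
  have "h \<le> W" using card_kept_le[of N] assms(1,2) by simp
  then show ?thesis
    using assms bnd_meet[of _ h _ W b m] rank_less by (simp add: check_expr_def less_imp_le)
qed

lemma holds_search:
  assumes h: "h = card {v. M.kept N v}" and b: "b = h + h"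
  shows "holds xs search_expr [s, N, m, h, b] \<longleftrightarrow> irep {v. M.kept N v} E m"
proof -
  let ?K = "{v. M.kept N v}"
  have *: "holds xs search_expr [s, N, m, h, b] \<longleftrightarrow>
    (\<exists>z<2 ^ (b * (2 * (h * m))). \<forall>u\<in>?K. \<forall>v\<in>?K. E u v \<longleftrightarrow> coded N m b z u v)"
    by (simp add: search_expr_def mult_2)
  show ?thesis
  proof
    assume "holds xs search_expr [s, N, m, h, b]"
    then obtain z where z: "\<forall>u\<in>?K. \<forall>v\<in>?K. E u v \<longleftrightarrow> coded N m b z u v" unfolding * by blast
    show "irep ?K E m"
      unfolding irep_def
      by (rule exI[of _ "\<lambda>u i. real (digit z b (2 * (rank N u * m + i)))"],
          rule exI[of _ "\<lambda>u i. real (digit z b (2 * (rank N u * m + i) + 1))"])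
        (use z in \<open>simp add: coded_def\<close>)
  next
    assume "irep ?K E m"
    then obtain l r :: "nat \<Rightarrow> nat \<Rightarrow> nat" where
      lr: "\<forall>u\<in>?K. \<forall>i. l u i < 2 * card ?K \<and> r u i < 2 * card ?K"
      and E: "\<forall>u\<in>?K. \<forall>v\<in>?K. E u v \<longleftrightarrow> (\<forall>i<m. l u i \<le> r v i \<and> l v i \<le> r u i)"
      using irep_bounded_nat[OF finite_kept] by blast
    define w where "w = inv_into ?K (rank N)"
    have w: "w (rank N u) = u" if "u \<in> ?K" for u
      unfolding w_def using bij_rank that by (simp add: bij_betw_def)
    have wK: "w k \<in> ?K" if "k < h" for k
      unfolding w_def using bij_rank that h by (intro inv_into_into) (auto simp: bij_betw_def)
    \<comment> \<open>The inverse of the digit numbering: parity selects the side, and half the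
      position splits into rank and axis.\<close>
    define g where "g p = (if even p then l (w (p div 2 div m)) (p div 2 mod m)
      else r (w (p div 2 div m)) (p div 2 mod m))" for p
    have "g p < 2 ^ b" if "p < 2 * (h * m)" for p
    proof -
      have "p div 2 div m < h" using that by (simp add: less_mult_imp_div_less)
      \<comment> \<open>The integer endpoints are below \<open>2 * h\<close>, which is
        \<open>b\<close>, and \<open>b < 2 ^ b\<close>.\<close>
      then have "g p < b" using lr wK h b unfolding g_def by (auto simp: mult_2)
      then show ?thesis using less_exp[of b] by linarith
    qed
    then obtain z where z: "z < 2 ^ (b * (2 * (h * m)))" "\<forall>p<2 * (h * m). digit z b p = g p"
      using digits_exist[of "2 * (h * m)" g b] by blast
    have pos: "2 * (rank N u * m + i) + 1 < 2 * (h * m)" if "u \<in> ?K" "i < m" for u i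
    proof -
      have "Suc (rank N u) * m \<le> h * m" using rank_less[of N u] that h by (intro mult_le_mono1) simp
      then show ?thesis using that by simp
    qed
    have dl: "digit z b (2 * (rank N u * m + i)) = l u i" if "u \<in> ?K" "i < m" for u i
      using z(2) pos[OF that] w that by (simp add: g_def)
    have dr: "digit z b (2 * (rank N u * m + i) + 1) = r u i" if "u \<in> ?K" "i < m" for u i
      using z(2) pos[OF that] w that by (simp add: g_def)
    have "\<forall>u\<in>?K. \<forall>v\<in>?K. E u v \<longleftrightarrow> coded N m b z u v"
      using E dl dr unfolding coded_def by simp
    then show "holds xs search_expr [s, N, m, h, b]" unfolding * using z(1) by blast
  qed
qed

lemma bnd_search:
  assumes "n \<le> W" "h = card {v. M.kept N v}" "b \<le> W" "2 ^ (b * (2 * (h * m))) \<le> W" "m \<le> W"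
  shows "bnd W xs search_expr [s, N, m, h, b]"
proof -
  have "h \<le> W" using card_kept_le[of N] assms(1,2) by simp
  moreover have "b * (2 * (h * m)) \<le> W" using less_exp[of "b * (2 * (h * m))"] assms(4) by linarith
  ultimately show ?thesis
    using assms bnd_check[of W h N b m] by (simp add: search_expr_def mult_2)
qed

end

section \<open>Correctness and running time\<close>

definition type_bound :: "nat \<Rightarrow> nat" where
  "type_bound s = 2 * 2 ^ s + 4 * s"

text \<open>The bound of \<open>card_kept\<close> for the threshold belonging to the largest
  possible dimension \<open>s + 1\<close>.\<close>

definition kernel_bound :: "nat \<Rightarrow> nat" where
  "kernel_bound s = s + 2 ^ (2 ^ s) * ((2 ^ (type_bound s * (s + 1)) + 1) * 2 ^ s)"

text \<open>The first summand bounds the exponent of the search, with a digit width of twice the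
  kernel size; the others cover the remaining loop lengths that do not involve
  \<open>n\<close>.\<close>

definition loop_bound :: "nat \<Rightarrow> nat" where
  "loop_bound s = 2 * kernel_bound s * (2 * (kernel_bound s * (s + 1))) + type_bound s +
     type_bound s * (s + 1) + 2 * kernel_bound s + (s + 1)"

lemma type_bound_mono: "s \<le> t \<Longrightarrow> type_bound s \<le> type_bound t"
  unfolding type_bound_def by (intro add_mono mult_le_mono power_increasing) auto

lemma kernel_bound_mono: "s \<le> t \<Longrightarrow> kernel_bound s \<le> kernel_bound t"
  unfolding kernel_bound_def
  by (intro add_mono mult_le_mono power_increasing type_bound_mono) auto

text \<open>The size of the modulator is only known to be at most three times the parameter, while
  the time bound may depend on nothing but the parameter.\<close>

lemma loop_bound_mono: "s \<le> t \<Longrightarrow> loop_bound s \<le> loop_bound t"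
  unfolding loop_bound_def
  by (intro add_mono mult_le_mono kernel_bound_mono type_bound_mono) auto

definition "loop_bound_expr =
   Bind (Plus (Plus (Call pow2_expr [Var 0]) (Call pow2_expr [Var 0])) (Plus (Plus (Var 0) (Var 0)) (Plus (Var 0) (Var 0))))
   (Bind (Plus (Var 0) (Num 1))
   (Bind (Call mul_expr [Var 1, Var 2])
   (Bind (Plus (Var 0) (Call mul_expr [Call pow2_expr [Call pow2_expr [Var 0]],
      Call mul_expr [Plus (Call pow2_expr [Var 3]) (Num 1), Call pow2_expr [Var 0]]]))
   (Plus (Plus (Plus (Plus (Call mul_expr [Plus (Var 4) (Var 4), Plus (Call mul_expr [Var 4, Var 2]) (Call mul_expr [Var 4, Var 2])])
      (Var 1)) (Var 3)) (Plus (Var 4) (Var 4))) (Var 2)))))"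

lemma eval_loop_bound: "eval xs loop_bound_expr [s] = loop_bound s"
proof -
  have c: "2 ^ s + 2 ^ s + (s + s + (s + s)) = type_bound s" by (simp add: type_bound_def)
  have h: "s + 2 ^ 2 ^ s * ((2 ^ (type_bound s * (s + 1)) + 1) * 2 ^ s) = kernel_bound s"
    by (simp add: kernel_bound_def)
  show ?thesis
    by (simp add: loop_bound_expr_def c h[simplified] loop_bound_def) (simp flip: mult_2)
qed

definition "time_expr K D = Call mul_expr [Num K, Call pow2_expr [Call mul_expr
   [Call loop_bound_expr [Plus (Inp (Num 0)) (Plus (Inp (Num 0)) (Inp (Num 0)))], Num D]]]"

lemma eval_time: "eval [k] (time_expr K D) [] = K * 2 ^ (loop_bound (3 * k) * D)"
proof -
  have "3 * k = k + (k + k)" by simp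
  then show ?thesis by (simp only:) (simp add: time_expr_def eval_loop_bound)
qed

section \<open>The whole algorithm\<close>

context boxicity_input
begin

lemma modulator: "cluster_modulator n E (bitset (greedy path3 n))"
  and card_modulator: "card (bitset (greedy path3 n)) \<le> 3 * cluster_vertex_deletion_number (with_proj G)"
proof -
  \<comment> \<open>As \<open>E\<close> is reflexive, the three conditions in \<open>path3\<close>
    are contradictory as soon as two of the vertices coincide.\<close>
  have distinct: "u \<noteq> v \<and> v \<noteq> w \<and> u \<noteq> w" if "path3 u v w" for u v w
    using that by (auto simp: path3_def E_def)
  obtain X where X: "X \<subseteq> pverts G" "card X = cluster_vertex_deletion_number (with_proj G)"
    "\<And>u v w. \<lbrakk>(u, v) \<in> parcs G; (v, w) \<in> parcs G; (u, w) \<notin> parcs G; u \<noteq> w\<rbrakk> \<Longrightarrow> u \<in> X \<or> v \<in> X \<or> w \<in> X"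
    using cluster_vertex_deletion_set[OF graph] by blast
  have finX: "finite X" using X(1) verts finite_subset by auto
  have hit: "u \<in> X \<or> v \<in> X \<or> w \<in> X" if "path3 u v w" for u v w
    using distinct[OF that] that X(3)[of u v w] by (auto simp: path3_def E_def)
  note small = greedy_small[of path3 X n, OF distinct finX hit]
  then show "card (bitset (greedy path3 n)) \<le> 3 * cluster_vertex_deletion_number (with_proj G)"
    using X(2) by simp
  show "cluster_modulator n E (bitset (greedy path3 n))"
  proof
    show "E u v \<longleftrightarrow> E v u" for u v by (rule E_sym)
    show "E v v" for v by (simp add: E_def)
    show "bitset (greedy path3 n) \<subseteq> {..<n}" by (rule small(1))
    show "E u w" if "u \<in> {..<n} - bitset (greedy path3 n)" "v \<in> {..<n} - bitset (greedy path3 n)"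
      "w \<in> {..<n} - bitset (greedy path3 n)" "E u v" "E v w" for u v w
      using greedy_maximal[of path3 u v w n, OF distinct] that by (auto simp: path3_def)
  qed
qed

lemma boxicity_le_iff_irep:
  assumes "irep {..<n} E k"
  shows "boxicity (with_proj G) \<le> m \<longleftrightarrow> irep {..<n} E m"
proof -
  have radj: "radj (with_proj G) = E"
    by (intro ext) (auto simp: E_def arcs_ends_def arc_to_ends_def)
  have V: "verts (with_proj G) = {..<n}" by (simp add: verts lessThan_atLeast0)
  show ?thesis using boxicity_le_iff[of "with_proj G" k m, unfolded radj V, OF assms] .
qed

lemma eval_search: "eval xs search_expr env = of_bool (holds xs search_expr env)"
  by (simp add: search_expr_def eval_Exists del: Call_def)

lemma eval_exponent [simp]: "eval xs exponent_expr [k, m] = type_bound k * m"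
proof -
  have "2 ^ k + 2 ^ k + (k + k + (k + k)) = type_bound k" by (simp add: type_bound_def)
  then show ?thesis by (simp add: exponent_expr_def)
qed

lemma bnd_exponent [simp]: "bnd W xs exponent_expr [k, m] \<longleftrightarrow> k \<le> W \<and> type_bound k \<le> W"
proof -
  have "2 ^ k + 2 ^ k + (k + k + (k + k)) = type_bound k" by (simp add: type_bound_def)
  then show ?thesis by (simp add: exponent_expr_def)
qed

lemma main_correct:
  fixes W :: nat
  assumes W: "2 ^ loop_bound (3 * cluster_vertex_deletion_number (with_proj G)) * max 1 n \<le> W"
  shows "eval xs main_expr [] = (if int (boxicity (with_proj G)) \<le> d then 1 else 0)"
    and "bnd W xs main_expr []"
proof -
  define s where "s = greedy path3 n"
  interpret boxicity_modulator G n d xs s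
    unfolding s_def
    by (intro boxicity_modulator.intro boxicity_input_axioms boxicity_modulator_axioms.intro modulator)
  define k where "k = card (bitset s)"
  define m where "m = capped_dim k"
  define N :: nat where "N = 2 ^ (type_bound k * m)"
  define h where "h = card {v. M.kept N v}"
  have count: "card {i. i < n \<and> bit s i} = k"
    unfolding k_def by (rule arg_cong[of _ _ card]) (auto dest: bit_less)
  have eval: "eval xs main_expr [] =
      (if d < 0 then 0 else of_bool (holds xs search_expr [s, N, m, h, h + h]))"
    by (simp add: main_expr_def eval_greedy s_def[symmetric] eval_Cnt count m_def[symmetric]
        N_def[symmetric] rank_n h_def[symmetric] eval_search)
  have full: "irep {..<n} E (k + 1)" unfolding k_def by (rule M.irep_card_modulator)
  have "2 ^ ((2 * 2 ^ card (bitset s) + 4 * card (bitset s)) * m) \<le> N"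
    by (simp add: N_def type_bound_def k_def)
  then have kept: "holds xs search_expr [s, N, m, h, h + h] \<longleftrightarrow> irep {..<n} E m"
    using holds_search[OF h_def HOL.refl] M.irep_kept by simp
  show "eval xs main_expr [] = (if int (boxicity (with_proj G)) \<le> d then 1 else 0)"
  proof (cases "d < 0")
    case True
    then show ?thesis unfolding eval by simp
  next
    case False
    \<comment> \<open>Either the cap is inactive, or both sides hold because \<open>k + 1\<close>
      axes always suffice.\<close>
    have "irep {..<n} E m \<longleftrightarrow> irep {..<n} E (nat d)"
      using False full irep_mono[OF full, of "nat d"] by (auto simp: m_def capped_dim_def min_def)
    also have "\<dots> \<longleftrightarrow> boxicity (with_proj G) \<le> nat d" using boxicity_le_iff_irep[OF full] by simp
    also have "\<dots> \<longleftrightarrow> int (boxicity (with_proj G)) \<le> d" using False by linarith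
    finally show ?thesis unfolding eval kept using False by simp
  qed
  let ?t = "3 * cluster_vertex_deletion_number (with_proj G)"
  have kt: "k \<le> ?t" using card_modulator by (simp add: k_def s_def)
  have mk: "m \<le> k + 1" by (simp add: m_def capped_dim_def)
  have Wn: "n \<le> W"
  proof -
    have "1 * max 1 n \<le> 2 ^ loop_bound ?t * max 1 n" by (rule mult_le_mono1) simp
    then show ?thesis using W by linarith
  qed
  have WX: "2 ^ loop_bound k \<le> W"
  proof -
    have "(2::nat) ^ loop_bound k \<le> 2 ^ loop_bound ?t"
      using loop_bound_mono[OF kt] by (intro power_increasing) auto
    also have "\<dots> \<le> 2 ^ loop_bound ?t * max 1 n" by simp
    finally show ?thesis using W by linarith
  qed
  have hk: "h \<le> kernel_bound k"
  proof -
    have "type_bound k * m \<le> type_bound k * (k + 1)" using mk by (rule mult_le_mono2)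
    then have "N \<le> 2 ^ (type_bound k * (k + 1))" unfolding N_def by (intro power_increasing) auto
    then have "Suc N * 2 ^ k \<le> (2 ^ (type_bound k * (k + 1)) + 1) * 2 ^ k" by (intro mult_le_mono1) simp
    then have "2 ^ 2 ^ k * (Suc N * 2 ^ k) \<le> 2 ^ 2 ^ k * ((2 ^ (type_bound k * (k + 1)) + 1) * 2 ^ k)"
      by (rule mult_le_mono2)
    then show ?thesis using M.card_kept[of N] unfolding h_def kernel_bound_def k_def by linarith
  qed
  have Lb: "j \<le> W" if "j \<le> loop_bound k" for j
    using that WX less_exp[of "loop_bound k"] by linarith
  have e: "(h + h) * (2 * (h * m)) \<le> loop_bound k"
  proof -
    have "(h + h) * (2 * (h * m)) \<le> 2 * kernel_bound k * (2 * (kernel_bound k * (k + 1)))"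
      using hk mk by (intro mult_le_mono) auto
    then show ?thesis unfolding loop_bound_def by linarith
  qed
  have b1: "k \<le> W" "type_bound k \<le> W" "m \<le> W" "h + h \<le> W"
    using hk mk by (auto intro!: Lb simp: loop_bound_def)
  have b2: "type_bound k * m \<le> W"
  proof (rule Lb)
    have "type_bound k * m \<le> type_bound k * (k + 1)" using mk by (rule mult_le_mono2)
    then show "type_bound k * m \<le> loop_bound k" unfolding loop_bound_def by linarith
  qed
  have b3: "2 ^ ((h + h) * (2 * (h * m))) \<le> W"
  proof -
    have "(2::nat) ^ ((h + h) * (2 * (h * m))) \<le> 2 ^ loop_bound k"
      using e by (intro power_increasing) auto
    then show ?thesis using WX by linarith
  qed
  have "bnd W xs search_expr [s, N, m, h, h + h]"
    by (rule bnd_search[OF Wn h_def b1(4) b3 b1(3)])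
  then show "bnd W xs main_expr []"
    using Wn b1 b2
    by (simp add: main_expr_def eval_greedy s_def[symmetric] eval_Cnt count m_def[symmetric]
        N_def[symmetric] rank_n h_def[symmetric] bnd_greedy)
qed

end

lemma outputs_within_mono: "outputs_within P xs T y \<Longrightarrow> T \<le> T' \<Longrightarrow> outputs_within P xs T' y"
  unfolding outputs_within_def using le_trans by blast

theorem theorem1:
  shows "\<exists>f. computable f \<and>
    (\<exists>(P :: instr list) (c :: nat). \<forall>(G :: nat pair_pre_digraph) (n :: nat) (d :: int).
      pair_graph G \<and> pverts G = {0..<n} \<longrightarrow>
      outputs_within P (boxicity_instance G d)
        (f (cluster_vertex_deletion_number G) * max 1 n ^ c)
        (if int (boxicity G) \<le> d then 1 else 0))"
proof -
  \<comment> \<open>The program is fixed, so \<open>D\<close> is a constant and serves as the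
    exponent of the polynomial factor.\<close>
  obtain K D where KD: "\<forall>W\<ge>1. tcost W main_expr \<le> K * W ^ D"
    using tcost_polynomial by blast
  have "outputs_within (comp main_expr 0 [] 0) (boxicity_instance G d)
      (eval [cluster_vertex_deletion_number G] (time_expr K D) [] * max 1 n ^ D)
      (if int (boxicity G) \<le> d then 1 else 0)"
    if "pair_graph G" "pverts G = {0..<n}" for G :: "nat pair_pre_digraph" and n :: nat and d :: int
  proof -
    interpret boxicity_input G n d "boxicity_instance G d" by (intro boxicity_input.intro that HOL.refl)
    define X where "X = loop_bound (3 * cluster_vertex_deletion_number (with_proj G))"
    \<comment> \<open>\<open>max 1 n\<close> keeps \<open>W\<close> positive for the empty graph, as
      the polynomial bound on \<open>tcost\<close> requires.\<close>
    define W where "W = 2 ^ X * max 1 n"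
    have "tcost W main_expr \<le> K * W ^ D" using KD by (simp add: W_def)
    also have "\<dots> = K * 2 ^ (X * D) * max 1 n ^ D"
      by (simp add: W_def power_mult_distrib power_mult)
    finally have "tcost W main_expr \<le>
        eval [cluster_vertex_deletion_number G] (time_expr K D) [] * max 1 n ^ D"
      by (simp only: eval_time X_def)
    moreover have "outputs_within (comp main_expr 0 [] 0) (boxicity_instance G d) (tcost W main_expr)
        (if int (boxicity G) \<le> d then 1 else 0)"
      using eval_outputs_within[OF main_correct(2)[of W]] main_correct(1)[of W]
      by (simp add: W_def X_def)
    ultimately show ?thesis using outputs_within_mono by blast
  qed
  then show ?thesis
    by (intro exI[of _ "\<lambda>k. eval [k] (time_expr K D) []"] conjI eval_computable) blast
qed

end
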